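(* Assume that $\psi$ is strongly convex with parameter $\mu>0$, i.e. for all $x,y\in\operatorname{dom}\psi$ and $\psi'(x)\in\partial\psi(x)$, $\psi(y)\ge\psi(x)+\langle\psi'(x),y-x\rangle+\frac{\mu}{2}\|y-x\|^2$. (1) Let $A_k:=k^5$, and consequently $\gamma_k:=1-\bigl(\frac{k}{k+1}\bigr)^5=O(1/k)$. There is an absolute constant $C>0$ such that for every sequence $\{x_k\}$ generated by the Contracting-Domain Newton Method I (defined in the context) with these $\gamma_k$, for all $k\ge1$, $$F(x_k)-F^*\;\le\;\ell_k\;\le\;C\,\frac{H_\nu D^\nu}{\mu}\cdot\frac{H_\nu D^{2+\nu}}{k^{2+2\nu}}.$$ (2) Let $\omega_\nu:=\Bigl[\frac{H_\nu D^\nu}{(1+\nu)\mu}\Bigr]^{\frac{1}{1+\nu}}$ and assume $\omega_\nu>0$. Let $A_0:=0$, $A_k:=(1+\omega_\nu^{-1})^k$ for $k\ge1$, and $\gamma_0:=1$, $\gamma_k:=\frac{1}{1+\omega_\nu}$ for $k\ge1$. Then for every sequence $\{x_k\}$ generated by the Contracting-Domain Newton Method I with these $\gamma_k$, for all $k\ge1$, $$F(x_k)-F^*\;\le\;\ell_k\;\le\;\exp\Bigl(-\frac{k-1}{1+\omega_\nu}\Bigr)\cdot\frac{H_\nu D^{2+\nu}}{1+\nu}.$$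
   Context: Problem: minimize $F(x)=f(x)+\psi(x)$ over $x\in\mathbb{R}^n$, with optimal value $F^*$, where $\psi:\mathbb{R}^n\to\mathbb{R}\cup\{+\infty\}$ is a proper closed convex function and $f$ is convex and twice continuously differentiable at every point of $\operatorname{dom}\psi=\{x:\psi(x)<+\infty\}$. $\langle\cdot,\cdot\rangle$ is the standard scalar product on $\mathbb{R}^n$ and $\|\cdot\|$ is an arbitrary fixed (possibly non-Euclidean) norm on $\mathbb{R}^n$, with dual norm $\|s\|_*=\sup_{\|h\|\le 1}\langle s,h\rangle$ and induced matrix norm $\|A\|=\sup_{\|h\|\le1}\|Ah\|_*$. The domain is bounded: $D:=\sup_{x,y\in\operatorname{dom}\psi}\|x-y\|<+\infty$. The Hessian of $f$ is Hölder continuous of degree $\nu\in[0,1]$ on $\operatorname{dom}\psi$ with constant $0\le H_\nu<+\infty$: $\|\nabla^2 f(x)-\nabla^2 f(y)\|\le H_\nu\|x-y\|^\nu$ for all $x,y\in\operatorname{dom}\psi$. Contracting-Domain Newton Method I, with coefficients $\gamma_k\in(0,1]$: choose $x_0\in\operatorname{dom}\psi$; for $k\ge0$ take any $$v_{k+1}\in\operatorname{Argmin}_y\Bigl\{\langle\nabla f(x_k),y-x_k\rangle+\frac{\gamma_k}{2}\langle\nabla^2 f(x_k)(y-x_k),y-x_k\rangle+\psi(y)\Bigr\}$$ and set $x_{k+1}:=x_k+\gamma_k(v_{k+1}-x_k)$. In each part, given $\{A_k\}_{k\ge0}$ with $A_0=0$, put $a_k:=A_k-A_{k-1}$ for $k\ge1$,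 so that $\gamma_k=a_{k+1}/A_{k+1}$. For $k\ge1$, $\phi_k(x):=\sum_{i=1}^k a_i\bigl[f(x_i)+\langle\nabla f(x_i),x-x_i\rangle+\psi(x)\bigr]$, $\phi_k^*:=\min_x\phi_k(x)$, and $\ell_k:=F(x_k)-\phi_k^*/A_k$. An absolute constant is one independent of $k$, $n$, $\nu$, $H_\nu$, $D$, $\mu$, $f$, $\psi$, the norm and $x_0$. *)

theory Defs
  imports "HOL-Analysis.Analysis" "HOL-Library.Landau_Symbols"
begin

section \<open>The space of n-dimensional real vectors\<close>

text \<open>
  The dimension has to range below an existential quantifier (an absolute constant does not
  depend on it), so it cannot be a type. We realise the n-dimensional space as the subspace of those
  bounded real sequences that vanish from index n on. The ambient type carries the supremum
  norm; on each of these finite-dimensional subspaces it induces the usual topology, hence the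
  usual notions of limit, closedness and Frechet derivative. It is not the norm of the problem,
  which is an arbitrary function N satisfying the norm axioms on the subspace.
\<close>

type_synonym point = "nat \<Rightarrow>\<^sub>C real"

definition Rn :: "nat \<Rightarrow> point set" where
  "Rn n = {x. \<forall>i\<ge>n. apply_bcontfun x i = 0}"

lemma subspace_Rn: "subspace (Rn n)"
  by (auto simp: subspace_def Rn_def)

text \<open>Every n-tuple of coordinates is realised by exactly one element:\<close>

lemma Rn_coordinates: "\<exists>!x. x \<in> Rn n \<and> (\<forall>i<n. apply_bcontfun x i = c i)"
proof -
  define h where "h = (\<lambda>i. if i < n then c i else (0::real))"
  have "finite (range h)"
    by (rule finite_subset[of _ "insert 0 (c ` {..<n})"]) (auto simp: h_def)
  then have "h \<in> bcontfun"
    by (simp add: bcontfun_def finite_imp_bounded)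
  then have h: "apply_bcontfun (Bcontfun h) = h"
    by (rule Bcontfun_inverse)
  show ?thesis
  proof (rule ex1I[of _ "Bcontfun h"])
    show "Bcontfun h \<in> Rn n \<and> (\<forall>i<n. apply_bcontfun (Bcontfun h) i = c i)"
      unfolding Rn_def mem_Collect_eq h by (simp add: h_def)
  next
    fix y assume y: "y \<in> Rn n \<and> (\<forall>i<n. apply_bcontfun y i = c i)"
    show "y = Bcontfun h"
    proof (rule bcontfun_eqI)
      fix i show "apply_bcontfun y i = apply_bcontfun (Bcontfun h) i"
        unfolding h using y by (cases "i < n") (auto simp: h_def Rn_def)
    qed
  qed
qed

text \<open>
  Gradients, subgradients and other dual vectors are coordinate families, matrices are doubly
  indexed families; only the entries with indices below n are ever used.
\<close>

definition scp :: "nat \<Rightarrow> (nat \<Rightarrow> real) \<Rightarrow> point \<Rightarrow> real" where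
  "scp n s h = (\<Sum>i<n. s i * apply_bcontfun h i)"

definition mat_app :: "nat \<Rightarrow> (nat \<Rightarrow> nat \<Rightarrow> real) \<Rightarrow> point \<Rightarrow> nat \<Rightarrow> real" where
  "mat_app n A h = (\<lambda>i. \<Sum>j<n. A i j * apply_bcontfun h j)"

definition is_norm :: "nat \<Rightarrow> (point \<Rightarrow> real) \<Rightarrow> bool" where
  "is_norm n N \<longleftrightarrow>
     (\<forall>x\<in>Rn n. 0 \<le> N x \<and> (N x = 0 \<longleftrightarrow> x = 0)) \<and>
     (\<forall>x\<in>Rn n. \<forall>c. N (c *\<^sub>R x) = \<bar>c\<bar> * N x) \<and>
     (\<forall>x\<in>Rn n. \<forall>y\<in>Rn n. N (x + y) \<le> N x + N y)"

definition dual_norm :: "nat \<Rightarrow> (point \<Rightarrow> real) \<Rightarrow> (nat \<Rightarrow> real) \<Rightarrow> real" where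
  "dual_norm n N s = (SUP h\<in>{h \<in> Rn n. N h \<le> 1}. scp n s h)"

definition mat_norm :: "nat \<Rightarrow> (point \<Rightarrow> real) \<Rightarrow> (nat \<Rightarrow> nat \<Rightarrow> real) \<Rightarrow> real" where
  "mat_norm n N A = (SUP h\<in>{h \<in> Rn n. N h \<le> 1}. dual_norm n N (mat_app n A h))"

text \<open>
  Power of a nonnegative base with the convention that the zeroth power of 0 is 1; in contrast,
  powr yields 0 there. This matters for a Hoelder degree 0.
\<close>

definition hpow :: "real \<Rightarrow> real \<Rightarrow> real" where
  "hpow t a = (if a = 0 then 1 else t powr a)"


section \<open>Differentiability and convexity\<close>

text \<open>
  Twice continuous differentiability at a point: gradient g and Hessian Hs exist at all points of
  a neighbourhood (relative to the n-dimensional space), and Hs is continuous at the point.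
\<close>

definition C2_at ::
  "nat \<Rightarrow> (point \<Rightarrow> real) \<Rightarrow> (point \<Rightarrow> nat \<Rightarrow> real) \<Rightarrow> (point \<Rightarrow> nat \<Rightarrow> nat \<Rightarrow> real) \<Rightarrow> point \<Rightarrow> bool" where
  "C2_at n f g Hs x \<longleftrightarrow>
     (\<exists>U. open U \<and> x \<in> U \<and>
        (\<forall>y\<in>U \<inter> Rn n.
           (f has_derivative (\<lambda>h. scp n (g y) h)) (at y within Rn n) \<and>
           (\<forall>i<n. ((\<lambda>z. g z i) has_derivative (\<lambda>h. mat_app n (Hs y) h i)) (at y within Rn n)))) \<and>
     (\<forall>i<n. \<forall>j<n. continuous (at x within Rn n) (\<lambda>y. Hs y i j))"

definition dom :: "nat \<Rightarrow> (point \<Rightarrow> ereal) \<Rightarrow> point set" where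
  "dom n \<psi> = {x \<in> Rn n. \<psi> x < \<infinity>}"

definition epi :: "nat \<Rightarrow> (point \<Rightarrow> ereal) \<Rightarrow> (point \<times> real) set" where
  "epi n \<psi> = {(x, t). x \<in> Rn n \<and> \<psi> x \<le> ereal t}"

definition proper_closed_convex :: "nat \<Rightarrow> (point \<Rightarrow> ereal) \<Rightarrow> bool" where
  "proper_closed_convex n \<psi> \<longleftrightarrow>
     (\<forall>x\<in>Rn n. \<psi> x \<noteq> -\<infinity>) \<and> dom n \<psi> \<noteq> {} \<and> closed (epi n \<psi>) \<and> convex (epi n \<psi>)"

definition subdifferential :: "nat \<Rightarrow> (point \<Rightarrow> ereal) \<Rightarrow> point \<Rightarrow> (nat \<Rightarrow> real) set" where
  "subdifferential n \<psi> x = {s. \<forall>y\<in>Rn n. \<psi> x + ereal (scp n s (y - x)) \<le> \<psi> y}"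

definition strongly_convex :: "nat \<Rightarrow> (point \<Rightarrow> real) \<Rightarrow> (point \<Rightarrow> ereal) \<Rightarrow> real \<Rightarrow> bool" where
  "strongly_convex n N \<psi> \<mu> \<longleftrightarrow> 0 < \<mu> \<and>
     (\<forall>x\<in>dom n \<psi>. \<forall>y\<in>dom n \<psi>. \<forall>s\<in>subdifferential n \<psi> x.
        \<psi> x + ereal (scp n s (y - x) + \<mu> / 2 * (N (y - x))\<^sup>2) \<le> \<psi> y)"


section \<open>The optimization problem\<close>

definition diam :: "nat \<Rightarrow> (point \<Rightarrow> real) \<Rightarrow> (point \<Rightarrow> ereal) \<Rightarrow> real" where
  "diam n N \<psi> = (SUP (x, y)\<in>dom n \<psi> \<times> dom n \<psi>. N (x - y))"

text \<open>
  The function f matters only on (a neighbourhood of) the domain of \<open>\<psi>\<close>, so convexity is required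
  there.
\<close>

definition problem ::
  "nat \<Rightarrow> (point \<Rightarrow> real) \<Rightarrow> (point \<Rightarrow> real) \<Rightarrow> (point \<Rightarrow> nat \<Rightarrow> real) \<Rightarrow> (point \<Rightarrow> nat \<Rightarrow> nat \<Rightarrow> real) \<Rightarrow>
   (point \<Rightarrow> ereal) \<Rightarrow> real \<Rightarrow> real \<Rightarrow> bool" where
  "problem n N f g Hs \<psi> \<nu> H \<longleftrightarrow>
     is_norm n N \<and> proper_closed_convex n \<psi> \<and>
     convex_on (dom n \<psi>) f \<and> (\<forall>x\<in>dom n \<psi>. C2_at n f g Hs x) \<and>
     bdd_above ((\<lambda>(x, y). N (x - y)) ` (dom n \<psi> \<times> dom n \<psi>)) \<and>
     0 \<le> \<nu> \<and> \<nu> \<le> 1 \<and> 0 \<le> H \<and>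
     (\<forall>x\<in>dom n \<psi>. \<forall>y\<in>dom n \<psi>.
        mat_norm n N (\<lambda>i j. Hs x i j - Hs y i j) \<le> H * hpow (N (x - y)) \<nu>)"

definition objective :: "(point \<Rightarrow> real) \<Rightarrow> (point \<Rightarrow> ereal) \<Rightarrow> point \<Rightarrow> ereal" where
  "objective f \<psi> x = ereal (f x) + \<psi> x"

definition opt_value :: "nat \<Rightarrow> (point \<Rightarrow> real) \<Rightarrow> (point \<Rightarrow> ereal) \<Rightarrow> ereal" where
  "opt_value n f \<psi> = (INF x\<in>Rn n. objective f \<psi> x)"


section \<open>Contracting-Domain Newton Method I\<close>

definition newton_model ::
  "nat \<Rightarrow> (point \<Rightarrow> nat \<Rightarrow> real) \<Rightarrow> (point \<Rightarrow> nat \<Rightarrow> nat \<Rightarrow> real) \<Rightarrow> (point \<Rightarrow> ereal) \<Rightarrow>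
   real \<Rightarrow> point \<Rightarrow> point \<Rightarrow> ereal" where
  "newton_model n g Hs \<psi> c x y =
     ereal (scp n (g x) (y - x) + c / 2 * scp n (mat_app n (Hs x) (y - x)) (y - x)) + \<psi> y"

definition CDN_run ::
  "nat \<Rightarrow> (point \<Rightarrow> nat \<Rightarrow> real) \<Rightarrow> (point \<Rightarrow> nat \<Rightarrow> nat \<Rightarrow> real) \<Rightarrow> (point \<Rightarrow> ereal) \<Rightarrow>
   (nat \<Rightarrow> real) \<Rightarrow> (nat \<Rightarrow> point) \<Rightarrow> bool" where
  "CDN_run n g Hs \<psi> \<gamma> x \<longleftrightarrow> x 0 \<in> dom n \<psi> \<and>
     (\<exists>v. \<forall>k. is_arg_min (newton_model n g Hs \<psi> (\<gamma> k) (x k)) (\<lambda>y. y \<in> Rn n) (v (Suc k)) \<and>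
              x (Suc k) = x k + \<gamma> k *\<^sub>R (v (Suc k) - x k))"

definition step_coef :: "(nat \<Rightarrow> real) \<Rightarrow> nat \<Rightarrow> real" where
  "step_coef A k = (A (Suc k) - A k) / A (Suc k)"

definition lower_model ::
  "nat \<Rightarrow> (point \<Rightarrow> real) \<Rightarrow> (point \<Rightarrow> nat \<Rightarrow> real) \<Rightarrow> (point \<Rightarrow> ereal) \<Rightarrow>
   (nat \<Rightarrow> real) \<Rightarrow> (nat \<Rightarrow> point) \<Rightarrow> nat \<Rightarrow> point \<Rightarrow> ereal" where
  "lower_model n f g \<psi> A x k y =
     (\<Sum>i=1..k. ereal (A i - A (i - 1)) * (ereal (f (x i) + scp n (g (x i)) (y - x i)) + \<psi> y))"

definition gap ::
  "nat \<Rightarrow> (point \<Rightarrow> real) \<Rightarrow> (point \<Rightarrow> nat \<Rightarrow> real) \<Rightarrow> (point \<Rightarrow> ereal) \<Rightarrow>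
   (nat \<Rightarrow> real) \<Rightarrow> (nat \<Rightarrow> point) \<Rightarrow> nat \<Rightarrow> ereal" where
  "gap n f g \<psi> A x k =
     objective f \<psi> (x k) - (INF y\<in>Rn n. lower_model n f g \<psi> A x k y) / ereal (A k)"

definition A_pow :: "nat \<Rightarrow> real" where
  "A_pow k = real k ^ 5"

definition gamma_pow :: "nat \<Rightarrow> real" where
  "gamma_pow k = 1 - (real k / real (k + 1)) ^ 5"

definition omega :: "real \<Rightarrow> real \<Rightarrow> real \<Rightarrow> real \<Rightarrow> real" where
  "omega \<nu> H D \<mu> = (H * hpow D \<nu> / ((1 + \<nu>) * \<mu>)) powr (1 / (1 + \<nu>))"

definition A_geo :: "real \<Rightarrow> nat \<Rightarrow> real" where
  "A_geo w k = (if k = 0 then 0 else (1 + 1 / w) ^ k)"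

definition gamma_geo :: "real \<Rightarrow> nat \<Rightarrow> real" where
  "gamma_geo w k = (if k = 0 then 1 else 1 / (1 + w))"

end

theory Submission
  imports Defs
begin

text \<open>
Write \<open>F = f + \<psi>\<close>, \<open>\<gamma> = \<gamma>\<^sub>k\<close>, \<open>x = x\<^sub>k\<close>, \<open>v = v\<^sub>k\<^sub>+\<^sub>1\<close>, \<open>x' = x + \<gamma> (v - x)\<close>, \<open>d = \<parallel>v - x\<parallel>\<close> and
\<open>e = \<parallel>y - v\<parallel>\<close> for a point \<open>y\<close> of the domain. Everything rests on one inequality
(\<open>newton_step_progress\<close>):
\<open>(1 - \<gamma>) F(x) + \<gamma> [f(x') + \<langle>\<nabla>f(x'), y - x'\<rangle> + \<psi>(y)] \<ge> F(x') + \<gamma> G\<close>, where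
\<open>G = \<mu>/2 ((1 - \<gamma>) d\<^sup>2 + e\<^sup>2) - R e\<close> and \<open>R = H/(1 + \<nu>) (\<gamma> d)\<^sup>1\<^sup>+\<^sup>\<nu>\<close> bounds the error of the linearised
gradient. The term in \<open>e\<^sup>2\<close> comes from strong convexity at the minimiser \<open>v\<close>
of the Newton model, the term in \<open>d\<^sup>2\<close> from strong convexity of \<open>\<psi>\<close> on the segment from \<open>x\<close> to \<open>v\<close>.
Multiplied by \<open>A\<^sub>k\<^sub>+\<^sub>1\<close> and summed, it bounds the gap \<open>\<ell>\<^sub>k\<close> by the weighted mean of the amounts by which
\<open>G\<close> falls below zero (\<open>gap_bound\<close>).

For the polynomial weights, \<open>G \<ge> - R\<^sup>2 / (2 \<mu>)\<close> with \<open>R\<close> of order \<open>k\<^sup>-\<^sup>1\<^sup>-\<^sup>\<nu>\<close>, and averaging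
\<open>k\<^sup>-\<^sup>2\<^sup>-\<^sup>2\<^sup>\<nu>\<close> with weights of order \<open>k\<^sup>4\<close> preserves the order. For the geometric weights
\<open>R \<le> \<mu> (1 - \<gamma>) d\<close>, so that \<open>G \<ge> 0\<close> in every step but the first; the loss of the first
step is divided by the exponentially growing \<open>A\<^sub>k\<close>.

Strong convexity is a hypothesis at points with a subgradient only. At \<open>v\<close> a subgradient is minus the
gradient of the model (\<open>argmin_strong_support\<close>); that this gradient has the usual form needs the symmetry of
the Hessian (\<open>hessian_symmetric\<close>). The point \<open>x'\<close> may have no subgradient at all, and strong convexity along
segments is obtained by approximating \<open>x'\<close> with proximal points (\<open>strong_jensen\<close>), whose existence
follows from compactness of the domain's closure and closedness of the epigraph.
\<close>

section \<open>Coordinates, compactness and linear forms\<close>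

definition unit_vec :: "nat \<Rightarrow> point" where
  "unit_vec i = Bcontfun (\<lambda>j. if j = i then 1 else 0)"

lemma apply_unit_vec: "apply_bcontfun (unit_vec i) j = (if j = i then 1 else 0)"
proof -
  let ?h = "\<lambda>j. if j = i then 1 else (0::real)"
  have "finite (range ?h)"
    by (rule finite_subset[of _ "{0, 1}"]) auto
  then have "?h \<in> bcontfun"
    by (simp add: bcontfun_def finite_imp_bounded)
  then show ?thesis
    unfolding unit_vec_def by (simp add: Bcontfun_inverse)
qed

lemma unit_vec_in_Rn: "i < n \<Longrightarrow> unit_vec i \<in> Rn n"
  by (simp add: Rn_def apply_unit_vec)

lemma abs_coord_le_norm: "\<bar>apply_bcontfun (x::point) i\<bar> \<le> norm x"
  using norm_bounded[of x i] by (simp only: real_norm_def)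

lemma bounded_linear_coord: "bounded_linear (\<lambda>x::point. apply_bcontfun x i)"
  by (rule bounded_linear_intro[of _ 1])
     (auto simp: plus_bcontfun.rep_eq scaleR_bcontfun.rep_eq abs_coord_le_norm)

lemma apply_bcontfun_sum: "apply_bcontfun (\<Sum>j\<in>J. F j :: point) i = (\<Sum>j\<in>J. apply_bcontfun (F j) i)"
  using bounded_linear.linear[OF bounded_linear_coord] by (rule linear_sum)

lemma Rn_expansion:
  assumes "x \<in> Rn n"
  shows "x = (\<Sum>i<n. apply_bcontfun x i *\<^sub>R unit_vec i)"
proof (rule bcontfun_eqI)
  fix j
  have "(\<Sum>i<n. apply_bcontfun x i * (if j = i then 1 else 0)) = (if j < n then apply_bcontfun x j else 0)"
    by (simp add: if_distrib[of "\<lambda>c. _ * c"] cong: if_cong)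
  also have "\<dots> = apply_bcontfun x j"
    using assms by (auto simp: Rn_def)
  finally show "apply_bcontfun x j = apply_bcontfun (\<Sum>i<n. apply_bcontfun x i *\<^sub>R unit_vec i) j"
    by (simp add: apply_bcontfun_sum scaleR_bcontfun.rep_eq apply_unit_vec)
qed

lemma Rn_add: "x \<in> Rn n \<Longrightarrow> y \<in> Rn n \<Longrightarrow> x + y \<in> Rn n"
  and Rn_diff: "x \<in> Rn n \<Longrightarrow> y \<in> Rn n \<Longrightarrow> x - y \<in> Rn n"
  and Rn_scale: "x \<in> Rn n \<Longrightarrow> c *\<^sub>R x \<in> Rn n"
  and Rn_zero: "0 \<in> Rn n"
  using subspace_Rn[of n]
  by (auto intro: subspace_add subspace_diff subspace_scale subspace_0)

lemmas Rn_intros = Rn_add Rn_diff Rn_scale Rn_zero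

lemma closed_Rn: "closed (Rn n)"
proof -
  have "Rn n = (\<Inter>i\<in>{n..}. (\<lambda>x. apply_bcontfun x i) -` {0})"
    by (auto simp: Rn_def)
  moreover have "closed ((\<lambda>x::point. apply_bcontfun x i) -` {0})" for i
    using bounded_linear.continuous_on[OF bounded_linear_coord continuous_on_id]
    by (intro closed_vimage) auto
  ultimately show ?thesis by auto
qed

text \<open>
The ambient sequence space is infinite-dimensional, so the Heine-Borel property has to be obtained
by induction on the dimension: splitting off the last coordinate exhibits the ball as part of a
continuous image of a product of two compact sets.
\<close>

lemma compact_Rn_cball: "compact (Rn n \<inter> cball 0 r)"
proof (induction n arbitrary: r)
  case 0
  have "Rn 0 = {0}"
    by (auto simp: Rn_def intro!: bcontfun_eqI)
  then have "Rn 0 \<inter> cball 0 r \<subseteq> {0}" by auto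
  then show ?case
    by (metis compact_empty compact_sing subset_singletonD)
next
  case (Suc n)
  define K where "K = Rn n \<inter> cball (0::point) (r + r * norm (unit_vec n))"
  define T where "T = (\<lambda>(y, t). y + t *\<^sub>R unit_vec n) ` (K \<times> {- r..r})"
  have "compact T"
    unfolding T_def K_def
    by (intro compact_continuous_image compact_Times Suc.IH)
       (auto simp: case_prod_unfold intro!: continuous_intros)
  moreover have "Rn (Suc n) \<inter> cball 0 r \<subseteq> T"
  proof
    fix x assume x: "x \<in> Rn (Suc n) \<inter> cball 0 r"
    define t where "t = apply_bcontfun x n"
    have t: "\<bar>t\<bar> \<le> r"
      using x abs_coord_le_norm[of x n] by (auto simp: t_def)
    have "apply_bcontfun (x - t *\<^sub>R unit_vec n) i = 0" if "i \<ge> n" for i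
      using that x by (cases "i = n")
        (auto simp: minus_bcontfun.rep_eq scaleR_bcontfun.rep_eq apply_unit_vec t_def Rn_def)
    then have "x - t *\<^sub>R unit_vec n \<in> Rn n"
      by (simp add: Rn_def)
    moreover have "norm (x - t *\<^sub>R unit_vec n) \<le> r + r * norm (unit_vec n)"
    proof -
      have "norm (x - t *\<^sub>R unit_vec n) \<le> norm x + \<bar>t\<bar> * norm (unit_vec n)"
        using norm_triangle_ineq4[of x "t *\<^sub>R unit_vec n"] by simp
      also have "\<dots> \<le> r + r * norm (unit_vec n)"
        using x t by (intro add_mono mult_right_mono) auto
      finally show ?thesis .
    qed
    ultimately have "(x - t *\<^sub>R unit_vec n, t) \<in> K \<times> {- r..r}"
      using t by (auto simp: K_def)
    then have "(\<lambda>(y, t). y + t *\<^sub>R unit_vec n) (x - t *\<^sub>R unit_vec n, t) \<in> T"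
      unfolding T_def by (rule imageI)
    then show "x \<in> T" by simp
  qed
  ultimately show ?case
    using closed_Rn[of "Suc n"] by (metis closed_Int closed_cball compact_Int_closed inf.absorb_iff2)
qed

lemma bounded_linear_scp: "bounded_linear (scp n s)"
  unfolding scp_def
  by (intro bounded_linear_sum bounded_linear_const_mult bounded_linear_coord)

lemma linear_scp: "linear (scp n s)"
  by (rule bounded_linear.linear[OF bounded_linear_scp])

lemmas scp_right = linear_add[OF linear_scp] linear_diff[OF linear_scp] linear_cmul[OF linear_scp]
  linear_0[OF linear_scp]

lemma scp_add_left: "scp n (\<lambda>i. s i + t i) h = scp n s h + scp n t h"
  and scp_scale_left: "scp n (\<lambda>i. c * s i) h = c * scp n s h"
  and scp_minus_left: "scp n (\<lambda>i. - s i) h = - scp n s h"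
  by (simp_all add: scp_def algebra_simps sum.distrib sum_subtractf sum_distrib_left sum_negf)

lemma mat_app_scp: "mat_app n A h i = scp n (A i) h"
  by (simp add: mat_app_def scp_def)

definition bilin :: "nat \<Rightarrow> (nat \<Rightarrow> nat \<Rightarrow> real) \<Rightarrow> point \<Rightarrow> point \<Rightarrow> real" where
  "bilin n A u h = scp n (mat_app n A u) h"

lemma bilin_right: "bilin n A u (h + k) = bilin n A u h + bilin n A u k"
  "bilin n A u (h - k) = bilin n A u h - bilin n A u k"
  "bilin n A u (c *\<^sub>R h) = c * bilin n A u h"
  by (simp_all add: bilin_def scp_right)

lemma bilin_left: "bilin n A (u + v) h = bilin n A u h + bilin n A v h"
  "bilin n A (u - v) h = bilin n A u h - bilin n A v h"
  "bilin n A (c *\<^sub>R u) h = c * bilin n A u h"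
  by (simp_all add: bilin_def scp_def mat_app_scp scp_right algebra_simps sum.distrib
      sum_subtractf sum_distrib_left)

lemma bilin_matrix_diff: "bilin n (\<lambda>i j. A i j - B i j) u h = bilin n A u h - bilin n B u h"
  by (simp add: bilin_def mat_app_def scp_def algebra_simps sum_subtractf sum_distrib_left sum_distrib_right)

text \<open>
The squared Euclidean norm. It serves as a smooth regulariser below, because neither the norm of
the problem nor the supremum norm need be differentiable.
\<close>

definition sqnorm :: "nat \<Rightarrow> point \<Rightarrow> real" where
  "sqnorm n h = scp n (apply_bcontfun h) h"

lemma sqnorm_nonneg: "0 \<le> sqnorm n h"
  by (auto simp: sqnorm_def scp_def intro!: sum_nonneg)

lemma continuous_on_sqnorm: "continuous_on S (\<lambda>y. sqnorm n (y - z))"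
proof -
  have "continuous_on S (\<lambda>y. apply_bcontfun (y - z) i)" for i
    by (intro bounded_linear.continuous_on[OF bounded_linear_coord] continuous_intros)
  then show ?thesis
    unfolding sqnorm_def scp_def by (intro continuous_intros)
qed

lemma norm_le_sqrt_sqnorm:
  assumes "h \<in> Rn n"
  shows "norm h \<le> sqrt (sqnorm n h)"
proof (rule norm_bound)
  fix i
  show "norm (apply_bcontfun h i) \<le> sqrt (sqnorm n h)"
  proof (cases "i < n")
    case True
    have "(apply_bcontfun h i)\<^sup>2 \<le> (\<Sum>i<n. (apply_bcontfun h i)\<^sup>2)"
      using True by (intro member_le_sum) auto
    then show ?thesis
      by (simp add: real_le_rsqrt sqnorm_def scp_def power2_eq_square)
  next
    case False
    then show ?thesis using assms sqnorm_nonneg by (auto simp: Rn_def)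
  qed
qed

section \<open>Norms and bilinear forms\<close>

context
  fixes n :: nat and N :: "point \<Rightarrow> real"
  assumes norm: "is_norm n N"
begin

lemma
  shows N_nonneg: "x \<in> Rn n \<Longrightarrow> 0 \<le> N x"
    and N_eq_0: "x \<in> Rn n \<Longrightarrow> N x = 0 \<longleftrightarrow> x = 0"
    and N_scale: "x \<in> Rn n \<Longrightarrow> N (c *\<^sub>R x) = \<bar>c\<bar> * N x"
    and N_triangle: "x \<in> Rn n \<Longrightarrow> y \<in> Rn n \<Longrightarrow> N (x + y) \<le> N x + N y"
  using norm by (auto simp: is_norm_def)

lemma N_minus_commute:
  assumes "x \<in> Rn n" "y \<in> Rn n"
  shows "N (x - y) = N (y - x)"
  using N_scale[of "y - x" "-1"] assms by (simp add: Rn_diff)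

text \<open>
This lemma and \<open>norm_le_multiple_N\<close> below are the two halves of the equivalence of norms in
finite dimension. They transport continuity and boundedness between the ambient supremum norm,
in which limits and derivatives are taken, and the norm of the problem.
\<close>

lemma N_le_multiple_norm: "\<exists>K\<ge>0. \<forall>x\<in>Rn n. N x \<le> K * norm x"
proof (intro exI conjI ballI)
  show "0 \<le> (\<Sum>i<n. N (unit_vec i))"
    by (intro sum_nonneg N_nonneg unit_vec_in_Rn) auto
  fix x assume x: "x \<in> Rn n"
  have "(\<Sum>i\<in>I. c i *\<^sub>R unit_vec i) \<in> Rn n \<and>
      N (\<Sum>i\<in>I. c i *\<^sub>R unit_vec i) \<le> (\<Sum>i\<in>I. \<bar>c i\<bar> * N (unit_vec i))"
    if "finite I" "I \<subseteq> {..<n}" for I c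
    using that
  proof (induction I rule: finite_induct)
    case empty
    then show ?case using N_eq_0[of 0] by (simp add: Rn_zero)
  next
    case (insert j I)
    then have "unit_vec j \<in> Rn n" by (intro unit_vec_in_Rn) auto
    then show ?case
      using insert N_triangle[of "c j *\<^sub>R unit_vec j" "\<Sum>i\<in>I. c i *\<^sub>R unit_vec i"]
      by (auto simp: Rn_intros N_scale)
  qed
  from this[of "{..<n}" "apply_bcontfun x"] Rn_expansion[OF x]
  have "N x \<le> (\<Sum>i<n. \<bar>apply_bcontfun x i\<bar> * N (unit_vec i))"
    by simp
  also have "\<dots> \<le> (\<Sum>i<n. norm x * N (unit_vec i))"
    by (intro sum_mono mult_right_mono abs_coord_le_norm N_nonneg unit_vec_in_Rn) auto
  finally show "N x \<le> (\<Sum>i<n. N (unit_vec i)) * norm x"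
    by (simp add: sum_distrib_left mult.commute)
qed

lemma continuous_on_N: "continuous_on (Rn n) N"
proof -
  obtain K where K: "K \<ge> 0" "\<And>x. x \<in> Rn n \<Longrightarrow> N x \<le> K * norm x"
    using N_le_multiple_norm by blast
  have "\<bar>N x - N y\<bar> \<le> K * dist x y" if "x \<in> Rn n" "y \<in> Rn n" for x y
    using N_triangle[of "x - y" y] N_triangle[of "y - x" x] K(2)[of "x - y"] that
      N_minus_commute[OF that]
    by (simp add: Rn_diff dist_norm)
  then have "K-lipschitz_on (Rn n) N"
    using K(1) by (intro lipschitz_onI) (auto simp: dist_real_def)
  then show ?thesis
    by (rule lipschitz_on_continuous_on)
qed

lemma norm_le_multiple_N: "\<exists>c\<ge>0. \<forall>x\<in>Rn n. norm x \<le> c * N x"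
proof -
  define S where "S = Rn n \<inter> sphere (0::point) 1"
  have cS: "compact S"
  proof -
    have "S = (Rn n \<inter> cball 0 1) \<inter> norm -` {1}" by (auto simp: S_def)
    moreover have "closed (norm -` {1::real} :: point set)"
      by (intro closed_vimage continuous_intros)
    ultimately show ?thesis
      using compact_Int_closed[OF compact_Rn_cball] by metis
  qed
  have "\<exists>c\<ge>0. \<forall>x\<in>S. 1 \<le> c * N x"
  proof (cases "S = {}")
    case False
    have "continuous_on S N"
      by (rule continuous_on_subset[OF continuous_on_N]) (auto simp: S_def)
    from continuous_attains_inf[OF cS False this]
    obtain m where m: "m \<in> S" "\<And>x. x \<in> S \<Longrightarrow> N m \<le> N x"
      by blast
    then have "0 < N m"
      using N_eq_0[of m] N_nonneg[of m] by (auto simp: S_def)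
    with m show ?thesis
      by (intro exI[of _ "1 / N m"]) (auto simp: field_simps)
  qed auto
  then obtain c where c: "c \<ge> 0" "\<And>x. x \<in> S \<Longrightarrow> 1 \<le> c * N x" by blast
  have "norm x \<le> c * N x" if x: "x \<in> Rn n" for x
  proof (cases "x = 0")
    case False
    then have "(1 / norm x) *\<^sub>R x \<in> S"
      using x by (simp add: S_def Rn_scale)
    from c(2)[OF this] show ?thesis
      using x False by (simp add: N_scale field_simps)
  qed (use c(1) x N_nonneg in auto)
  with c(1) show ?thesis by blast
qed

text \<open>
The two nested suprema in the matrix norm are upper bounds only if they range over sets that are
bounded above, which holds because the unit ball of \<open>N\<close> has bounded coordinates; the
inequality then extends from unit vectors by homogeneity.
\<close>

lemma bilin_le_mat_norm:
  assumes u: "u \<in> Rn n" and h: "h \<in> Rn n"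
  shows "bilin n A u h \<le> mat_norm n N A * N u * N h"
proof -
  define B where "B = {h \<in> Rn n. N h \<le> 1}"
  obtain c where c: "c \<ge> 0" "\<And>x. x \<in> Rn n \<Longrightarrow> norm x \<le> c * N x"
    using norm_le_multiple_N by blast
  have coord: "\<bar>apply_bcontfun x i\<bar> \<le> c" if "x \<in> B" for x i
    using abs_coord_le_norm[of x i] c(2)[of x] mult_left_mono[of "N x" 1 c] c(1) that
    by (auto simp: B_def)
  have sb: "scp n s x \<le> (\<Sum>i<n. \<bar>s i\<bar> * c)" if "x \<in> B" for s x
    unfolding scp_def
  proof (rule sum_mono)
    fix i
    have "s i * apply_bcontfun x i \<le> \<bar>s i\<bar> * \<bar>apply_bcontfun x i\<bar>"
      by (metis abs_ge_self abs_mult)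
    also have "\<dots> \<le> \<bar>s i\<bar> * c"
      by (intro mult_left_mono coord that) auto
    finally show "s i * apply_bcontfun x i \<le> \<bar>s i\<bar> * c" .
  qed
  have "0 \<in> B" using N_eq_0[of 0] by (simp add: B_def Rn_zero)
  then have B0: "B \<noteq> {}" by auto
  have dual: "scp n s x \<le> dual_norm n N s" if "x \<in> B" for s x
    unfolding dual_norm_def B_def[symmetric]
    by (rule cSUP_upper[OF that]) (use sb in \<open>auto simp: bdd_above_def\<close>)
  have Ab: "\<bar>mat_app n A x i\<bar> \<le> (\<Sum>j<n. \<bar>A i j\<bar> * c)" if "x \<in> B" for x i
    unfolding mat_app_def
    by (rule order_trans[OF sum_abs], rule sum_mono)
       (auto simp: abs_mult intro!: mult_left_mono coord that)
  have "dual_norm n N (mat_app n A x) \<le> (\<Sum>i<n. (\<Sum>j<n. \<bar>A i j\<bar> * c) * c)" if "x \<in> B" for x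
    unfolding dual_norm_def B_def[symmetric]
    by (rule cSUP_least[OF B0], rule order_trans[OF sb])
       (auto intro!: sum_mono mult_right_mono Ab that c(1))
  then have mat: "dual_norm n N (mat_app n A x) \<le> mat_norm n N A" if "x \<in> B" for x
    unfolding mat_norm_def B_def[symmetric]
    by (intro cSUP_upper[OF that]) (auto simp: bdd_above_def)
  have unit: "bilin n A x y \<le> mat_norm n N A" if "x \<in> B" "y \<in> B" for x y
    using dual[OF that(2), of "mat_app n A x"] mat[OF that(1)] by (simp add: bilin_def)
  show ?thesis
  proof (cases "u = 0 \<or> h = 0")
    case True
    then have zero: "bilin n A u h = 0" "N u * N h = 0"
      using bilin_left(3)[of n A 0 u h] bilin_right(3)[of n A u 0 h] N_eq_0[of 0]
      by (auto simp: Rn_zero)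
    show ?thesis by (simp only: mult.assoc zero mult_zero_right order_refl)
  next
    case False
    then have pos: "N u > 0" "N h > 0"
      using u h N_nonneg N_eq_0 by (auto simp: less_le)
    have "(1 / N u) *\<^sub>R u \<in> B" "(1 / N h) *\<^sub>R h \<in> B"
      using u h pos by (auto simp: B_def N_scale Rn_scale)
    from unit[OF this] have "bilin n A u h / (N u * N h) \<le> mat_norm n N A"
      by (simp add: bilin_left bilin_right field_simps)
    then show ?thesis using pos by (simp add: field_simps)
  qed
qed

end

section \<open>Derivatives and the symmetry of the Hessian\<close>

text \<open>
Differentiability relative to the subspace is turned into ordinary differentiability of the
restriction to a line, so that the mean value theorem and its relatives apply.
\<close>

lemma has_derivative_along_line:
  fixes F :: "point \<Rightarrow> real"
  assumes F: "(F has_derivative F') (at (a + s *\<^sub>R u) within Rn n)"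
    and a: "a \<in> Rn n" and u: "u \<in> Rn n"
  shows "((\<lambda>s. F (a + s *\<^sub>R u)) has_real_derivative F' u) (at s)"
proof -
  have line: "((\<lambda>s. a + s *\<^sub>R u) has_derivative (\<lambda>h. h *\<^sub>R u)) (at s)"
    by (auto intro!: derivative_eq_intros)
  have "range (\<lambda>s. a + s *\<^sub>R u) \<subseteq> Rn n"
    using a u by (auto intro: Rn_intros)
  from has_derivative_in_compose[OF line has_derivative_subset[OF F this]]
  have "((\<lambda>s. F (a + s *\<^sub>R u)) has_derivative (\<lambda>h. F' (h *\<^sub>R u))) (at s)" .
  moreover have "F' (h *\<^sub>R u) = F' u * h" for h
    using linear_cmul[OF has_derivative_linear[OF F], of h u] by simp
  ultimately show ?thesis
    by (simp add: has_field_derivative_def)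
qed

lemma scp_has_derivative:
  assumes "\<And>i. i < n \<Longrightarrow> ((\<lambda>z. g z i) has_derivative (\<lambda>h. mat_app n A h i)) (at y within Rn n)"
  shows "((\<lambda>z. scp n (g z) w) has_derivative (\<lambda>h. bilin n A h w)) (at y within Rn n)"
  unfolding scp_def bilin_def
  by (intro has_derivative_sum has_derivative_mult_left assms) auto

lemma C2_atD:
  assumes "C2_at n f g Hs x" "x \<in> Rn n"
  shows "(f has_derivative scp n (g x)) (at x within Rn n)"
    and "((\<lambda>z. scp n (g z) w) has_derivative (\<lambda>h. bilin n (Hs x) h w)) (at x within Rn n)"
  using assms by (auto simp: C2_at_def intro!: scp_has_derivative)

text \<open>
The classical argument for Schwarz's theorem: the mean value theorem in direction \<open>u\<close> reduces the
mixed second difference to a difference of gradients, and differentiability of the gradient at the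
single point \<open>x\<close> evaluates that difference up to \<open>o(t)\<close>.
\<close>

lemma second_difference_bound:
  assumes C2: "C2_at n f g Hs x" and x: "x \<in> Rn n" and u: "u \<in> Rn n" and w: "w \<in> Rn n"
    and e: "0 < e"
  shows "\<exists>t0>0. \<forall>t. 0 < t \<and> t < t0 \<longrightarrow>
    \<bar>f (x + t *\<^sub>R u + t *\<^sub>R w) - f (x + t *\<^sub>R u) - f (x + t *\<^sub>R w) + f x - t\<^sup>2 * bilin n (Hs x) w u\<bar>
      \<le> e * t\<^sup>2"
proof -
  define M where "M = norm u + norm w + 1"
  have M: "M > 0" by (simp add: M_def add_nonneg_pos)
  obtain U where U: "open U" "x \<in> U"
    and fU: "\<And>y. y \<in> U \<Longrightarrow> y \<in> Rn n \<Longrightarrow> (f has_derivative (\<lambda>h. scp n (g y) h)) (at y within Rn n)"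
    using C2 unfolding C2_at_def by blast
  obtain r where r: "r > 0" "ball x r \<subseteq> U"
    using U by (meson open_contains_ball)
  have "((\<lambda>z. scp n (g z) u) has_derivative (\<lambda>h. bilin n (Hs x) h u)) (at x within Rn n)"
    by (rule C2_atD(2)[OF C2 x])
  then obtain d where d: "d > 0"
    and gd: "\<And>z. z \<in> Rn n \<Longrightarrow> norm (z - x) < d \<Longrightarrow>
       \<bar>scp n (g z) u - scp n (g x) u - bilin n (Hs x) (z - x) u\<bar> \<le> e / (2 * M) * norm (z - x)"
    unfolding has_derivative_within_alt using e M
    by (metis divide_pos_pos mult_pos_pos real_norm_def zero_less_numeral)
  define t0 where "t0 = min r d / M"
  have "t0 > 0" using r d M by (simp add: t0_def)
  moreover have "\<bar>f (x + t *\<^sub>R u + t *\<^sub>R w) - f (x + t *\<^sub>R u) - f (x + t *\<^sub>R w) + f x - t\<^sup>2 * bilin n (Hs x) w u\<bar>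
      \<le> e * t\<^sup>2" if t: "0 < t" "t < t0" for t
  proof -
    have tM: "t * M < r" "t * M < d"
      using t M by (auto simp: t0_def field_simps)
    have small: "norm (s *\<^sub>R u + c *\<^sub>R w) \<le> t * M" if "0 \<le> s" "s \<le> t" "0 \<le> c" "c \<le> t" for s c
    proof -
      have "norm (s *\<^sub>R u + c *\<^sub>R w) \<le> s * norm u + c * norm w"
        using norm_triangle_ineq[of "s *\<^sub>R u" "c *\<^sub>R w"] that by simp
      also have "\<dots> \<le> t * norm u + t * norm w"
        using that by (intro add_mono mult_right_mono) auto
      also have "\<dots> \<le> t * M" using t by (simp add: M_def algebra_simps)
      finally show ?thesis .
    qed
    have inU: "x + s *\<^sub>R u + c *\<^sub>R w \<in> U" if "0 \<le> s" "s \<le> t" "0 \<le> c" "c \<le> t" for s c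
    proof -
      have "dist x (x + h) = norm h" for h by (simp add: dist_norm)
      then have "x + s *\<^sub>R u + c *\<^sub>R w \<in> ball x r"
        using small[OF that] tM unfolding mem_ball add.assoc by simp
      then show ?thesis using r by auto
    qed
    have f_line: "((\<lambda>s. f ((x + c *\<^sub>R w) + s *\<^sub>R u)) has_real_derivative
        scp n (g (x + s *\<^sub>R u + c *\<^sub>R w)) u) (at s)"
      if "0 \<le> s" "s \<le> t" "0 \<le> c" "c \<le> t" for s c
    proof -
      have eq: "(x + c *\<^sub>R w) + s *\<^sub>R u = x + s *\<^sub>R u + c *\<^sub>R w" by simp
      show ?thesis
        using fU[OF inU[OF that]] x u w unfolding eq[symmetric]
        by (intro has_derivative_along_line) (auto intro: Rn_intros)
    qed
    have der: "((\<lambda>s. f ((x + t *\<^sub>R w) + s *\<^sub>R u) - f ((x + 0 *\<^sub>R w) + s *\<^sub>R u)) has_real_derivative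
        scp n (g (x + s *\<^sub>R u + t *\<^sub>R w)) u - scp n (g (x + s *\<^sub>R u + 0 *\<^sub>R w)) u) (at s)"
      if "0 \<le> s" "s \<le> t" for s
      using that t by (intro DERIV_diff f_line) auto
    from MVT2[OF t(1) der] obtain s where s: "0 < s" "s < t" and
      mv: "f (x + t *\<^sub>R w + t *\<^sub>R u) - f (x + t *\<^sub>R u) - (f (x + t *\<^sub>R w) - f x) =
        t * (scp n (g (x + s *\<^sub>R u + t *\<^sub>R w)) u - scp n (g (x + s *\<^sub>R u + 0 *\<^sub>R w)) u)"
      by auto
    have near: "\<bar>scp n (g (x + s *\<^sub>R u + c *\<^sub>R w)) u - scp n (g x) u - bilin n (Hs x) (s *\<^sub>R u + c *\<^sub>R w) u\<bar>
        \<le> e / 2 * t" if "0 \<le> c" "c \<le> t" for c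
    proof -
      have eq: "x + s *\<^sub>R u + c *\<^sub>R w - x = s *\<^sub>R u + c *\<^sub>R w" by simp
      have sm: "norm (s *\<^sub>R u + c *\<^sub>R w) \<le> t * M" using small[of s c] s that by simp
      have "\<bar>scp n (g (x + s *\<^sub>R u + c *\<^sub>R w)) u - scp n (g x) u - bilin n (Hs x) (s *\<^sub>R u + c *\<^sub>R w) u\<bar>
          \<le> e / (2 * M) * norm (s *\<^sub>R u + c *\<^sub>R w)"
        using gd[of "x + s *\<^sub>R u + c *\<^sub>R w"] sm tM x u w unfolding eq by (simp add: Rn_intros)
      also have "\<dots> \<le> e / (2 * M) * (t * M)"
        using sm e M by (intro mult_left_mono) auto
      finally show ?thesis using M by simp
    qed
    \<comment> \<open>\<open>X\<close>, \<open>Z\<close> and \<open>Y\<close> are the products of \<open>u\<close> with the gradients at the two ends and at \<open>x\<close>.\<close>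
    have combine: "\<bar>X - Z - B\<bar> \<le> e * t"
      if "\<bar>X - Y - (A + B)\<bar> \<le> e / 2 * t" "\<bar>Z - Y - A\<bar> \<le> e / 2 * t" for X Y Z A B :: real
    proof -
      have "X - Z - B = (X - Y - (A + B)) - (Z - Y - A)" by simp
      also have "\<bar>\<dots>\<bar> \<le> e / 2 * t + e / 2 * t"
        by (rule order_trans[OF abs_triangle_ineq4 add_mono[OF that]])
      finally show ?thesis by simp
    qed
    have "\<bar>scp n (g (x + s *\<^sub>R u + t *\<^sub>R w)) u - scp n (g (x + s *\<^sub>R u + 0 *\<^sub>R w)) u
        - t * bilin n (Hs x) w u\<bar> \<le> e * t"
      using near[of t] near[of 0] t
      by (intro combine[where Y = "scp n (g x) u" and A = "s * bilin n (Hs x) u u"])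
         (simp_all add: bilin_left)
    then have "\<bar>t * (scp n (g (x + s *\<^sub>R u + t *\<^sub>R w)) u - scp n (g (x + s *\<^sub>R u + 0 *\<^sub>R w)) u
        - t * bilin n (Hs x) w u)\<bar> \<le> t * (e * t)"
      using t by (simp add: abs_mult)
    moreover have "f (x + t *\<^sub>R u + t *\<^sub>R w) - f (x + t *\<^sub>R u) - f (x + t *\<^sub>R w) + f x
        - t\<^sup>2 * bilin n (Hs x) w u =
       t * (scp n (g (x + s *\<^sub>R u + t *\<^sub>R w)) u - scp n (g (x + s *\<^sub>R u + 0 *\<^sub>R w)) u
        - t * bilin n (Hs x) w u)"
      using mv by (simp add: algebra_simps power2_eq_square)
    ultimately show ?thesis
      by (simp add: power2_eq_square mult_ac)
  qed
  ultimately show ?thesis by blast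
qed

text \<open>
The second difference is symmetric in the two directions, whereas its leading term is the Hessian
form. Symmetry is what makes \<open>\<nabla>f(x) + \<gamma> \<nabla>\<^sup>2f(x) (v - x)\<close> the gradient of the Newton model at \<open>v\<close>.
\<close>

lemma hessian_symmetric:
  assumes C2: "C2_at n f g Hs x" and x: "x \<in> Rn n" and u: "u \<in> Rn n" and w: "w \<in> Rn n"
  shows "bilin n (Hs x) u w = bilin n (Hs x) w u"
proof -
  have "\<bar>bilin n (Hs x) u w - bilin n (Hs x) w u\<bar> \<le> e" if "e > 0" for e
  proof -
    have e: "e / 2 > 0" using that by simp
    obtain t1 where t1: "t1 > 0" "\<And>t. 0 < t \<Longrightarrow> t < t1 \<Longrightarrow>
      \<bar>f (x + t *\<^sub>R u + t *\<^sub>R w) - f (x + t *\<^sub>R u) - f (x + t *\<^sub>R w) + f x - t\<^sup>2 * bilin n (Hs x) w u\<bar>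
      \<le> e / 2 * t\<^sup>2"
      using second_difference_bound[OF C2 x u w e] by blast
    obtain t2 where t2: "t2 > 0" "\<And>t. 0 < t \<Longrightarrow> t < t2 \<Longrightarrow>
      \<bar>f (x + t *\<^sub>R w + t *\<^sub>R u) - f (x + t *\<^sub>R w) - f (x + t *\<^sub>R u) + f x - t\<^sup>2 * bilin n (Hs x) u w\<bar>
      \<le> e / 2 * t\<^sup>2"
      using second_difference_bound[OF C2 x w u e] by blast
    define t where "t = min t1 t2 / 2"
    have t: "0 < t" "t < t1" "t < t2" using t1 t2 by (auto simp: t_def)
    have eq: "x + t *\<^sub>R w + t *\<^sub>R u = x + t *\<^sub>R u + t *\<^sub>R w" by simp
    have "\<bar>t\<^sup>2 * bilin n (Hs x) u w - t\<^sup>2 * bilin n (Hs x) w u\<bar> \<le> e * t\<^sup>2"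
      using t1(2)[OF t(1,2)] t2(2)[OF t(1,3)] unfolding eq by linarith
    then have "t\<^sup>2 * \<bar>bilin n (Hs x) u w - bilin n (Hs x) w u\<bar> \<le> t\<^sup>2 * e"
      by (simp add: abs_mult mult.commute flip: right_diff_distrib)
    then show ?thesis using t by simp
  qed
  then show ?thesis
    using field_le_epsilon[of "\<bar>bilin n (Hs x) u w - bilin n (Hs x) w u\<bar>" 0] by simp
qed

section \<open>Strongly convex composite problems\<close>

locale strongly_convex_composite =
  fixes n :: nat and N f g Hs \<psi> \<nu> H \<mu>
  assumes problem: "problem n N f g Hs \<psi> \<nu> H"
    and strongly_convex: "strongly_convex n N \<psi> \<mu>"
begin

abbreviation "Q \<equiv> dom n \<psi>"
abbreviation "D \<equiv> diam n N \<psi>"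

text \<open>
The finite values of \<open>\<psi>\<close>, so that the estimates on the domain take place in the real numbers.
\<close>

definition p :: "point \<Rightarrow> real" where "p y = real_of_ereal (\<psi> y)"

lemma is_norm: "is_norm n N"
  and proper: "proper_closed_convex n \<psi>"
  and f_convex: "convex_on Q f"
  and f_C2: "x \<in> Q \<Longrightarrow> C2_at n f g Hs x"
  and nu: "0 \<le> \<nu>" "\<nu> \<le> 1" and H: "0 \<le> H"
  and Hoelder: "x \<in> Q \<Longrightarrow> y \<in> Q \<Longrightarrow>
        mat_norm n N (\<lambda>i j. Hs x i j - Hs y i j) \<le> H * hpow (N (x - y)) \<nu>"
  and mu: "0 < \<mu>"
  using problem strongly_convex by (auto simp: problem_def strongly_convex_def)

lemmas N_simps = N_nonneg[OF is_norm] N_eq_0[OF is_norm] N_scale[OF is_norm] N_triangle[OF is_norm]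

lemma Q_Rn: "y \<in> Q \<Longrightarrow> y \<in> Rn n"
  by (simp add: dom_def)

lemma psi_real: "y \<in> Q \<Longrightarrow> \<psi> y = ereal (p y)"
  using proper by (cases "\<psi> y") (auto simp: dom_def p_def proper_closed_convex_def)

lemma psi_infinite: "y \<in> Rn n \<Longrightarrow> y \<notin> Q \<Longrightarrow> \<psi> y = \<infinity>"
  by (simp add: dom_def)

lemma mem_epi_iff: "(y, t) \<in> epi n \<psi> \<longleftrightarrow> y \<in> Q \<and> p y \<le> t"
proof (cases "y \<in> Q")
  case True
  then show ?thesis by (simp add: epi_def psi_real Q_Rn)
next
  case False
  then show ?thesis using psi_infinite[of y] by (auto simp: epi_def)
qed

lemma closed_epi: "closed (epi n \<psi>)" and convex_epi: "convex (epi n \<psi>)"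
  using proper by (auto simp: proper_closed_convex_def)

lemma p_convex:
  assumes "x \<in> Q" "y \<in> Q" "0 \<le> t" "t \<le> 1"
  shows "x + t *\<^sub>R (y - x) \<in> Q" "p (x + t *\<^sub>R (y - x)) \<le> (1 - t) * p x + t * p y"
proof -
  have "(1 - t) *\<^sub>R (x, p x) + t *\<^sub>R (y, p y) \<in> epi n \<psi>"
    using assms by (intro convexD[OF convex_epi]) (auto simp: mem_epi_iff)
  moreover have "(1 - t) *\<^sub>R (x, p x) + t *\<^sub>R (y, p y)
      = (x + t *\<^sub>R (y - x), (1 - t) * p x + t * p y)"
    by (simp add: algebra_simps)
  ultimately show "x + t *\<^sub>R (y - x) \<in> Q" "p (x + t *\<^sub>R (y - x)) \<le> (1 - t) * p x + t * p y"
    by (auto simp: mem_epi_iff)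
qed

lemma N_le_diam:
  assumes "x \<in> Q" "y \<in> Q"
  shows "0 \<le> N (x - y)" "N (x - y) \<le> D"
proof -
  show "0 \<le> N (x - y)" using assms by (simp add: N_simps Rn_intros Q_Rn)
  have "bdd_above ((\<lambda>(x, y). N (x - y)) ` (Q \<times> Q))"
    using problem by (simp add: problem_def)
  then have "(\<lambda>(x, y). N (x - y)) (x, y) \<le> D"
    unfolding diam_def using assms by (intro cSUP_upper) auto
  then show "N (x - y) \<le> D" by simp
qed

lemma Q_in_compact: "\<exists>K. compact K \<and> Q \<subseteq> K"
proof -
  obtain z where z: "z \<in> Q" using proper by (auto simp: proper_closed_convex_def)
  obtain c where c: "c \<ge> 0" "\<And>x. x \<in> Rn n \<Longrightarrow> norm x \<le> c * N x"
    using norm_le_multiple_N[OF is_norm] by blast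
  have "norm x \<le> norm z + c * D" if "x \<in> Q" for x
  proof -
    have "norm x \<le> norm z + norm (x - z)"
      using norm_triangle_ineq[of z "x - z"] by simp
    also have "norm (x - z) \<le> c * N (x - z)"
      using that z by (intro c(2) Rn_diff Q_Rn)
    also have "c * N (x - z) \<le> c * D"
      using that z c(1) by (intro mult_left_mono N_le_diam)
    finally show ?thesis by simp
  qed
  then have "Q \<subseteq> Rn n \<inter> cball 0 (norm z + c * D)"
    using Q_Rn by auto
  then show ?thesis using compact_Rn_cball by blast
qed

text \<open>
The sublevel sets for the levels \<open>0, -1, -2, \<dots>\<close> are closed subsets of a compact set. If none of
them were empty, a limit of points from all of them would have the value \<open>-\<infinity>\<close>.
\<close>

lemma p_bounded_below: "\<exists>L. \<forall>y\<in>Q. L \<le> p y"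
proof (rule ccontr)
  assume unbounded: "\<not> ?thesis"
  obtain K where K: "compact K" "Q \<subseteq> K" using Q_in_compact by blast
  define C where "C m = (\<lambda>y. (y, - real m)) -` epi n \<psi>" for m :: nat
  have CQ: "C m = {y \<in> Q. p y \<le> - real m}" for m
    by (auto simp: C_def mem_epi_iff)
  have closed: "closed (C m)" for m
    unfolding C_def by (intro closed_vimage closed_epi continuous_intros)
  have "\<exists>y. y \<in> C m" for m
    using unbounded unfolding CQ by (metis (mono_tags, lifting) mem_Collect_eq linear)
  then obtain Y where Y: "\<And>m. Y m \<in> C m" by metis
  then have YK: "\<forall>m. Y m \<in> K" using K(2) by (auto simp: CQ)
  have "seq_compact K" using K(1) by (simp add: compact_eq_seq_compact_metric)
  then obtain y r where r: "strict_mono r" and lim: "(Y \<circ> r) \<longlonglongrightarrow> y"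
    using YK by (rule seq_compactE)
  have "y \<in> C m" for m
  proof (rule Lim_in_closed_set[OF closed _ _ lim])
    show "\<forall>\<^sub>F k in sequentially. (Y \<circ> r) k \<in> C m"
      using eventually_ge_at_top[of m]
    proof eventually_elim
      case (elim k)
      then have "m \<le> r k" using seq_suble[OF r, of k] by linarith
      then show ?case using Y[of "r k"] by (auto simp: CQ)
    qed
  qed simp
  then have y: "p y \<le> - real m" for m
    by (auto simp: CQ)
  obtain m where "- p y < real m" using reals_Archimedean2 by blast
  with y[of m] show False by linarith
qed

text \<open>
Strong convexity is available only at points that have a subgradient. Minimisers of \<open>q + \<psi>\<close> with
a smooth \<open>q\<close> are such points: comparing the minimiser \<open>v\<close> with points close to it on a segment shows
that minus the gradient \<open>s\<close> of \<open>q\<close> at \<open>v\<close> is a subgradient of \<open>\<psi>\<close>. The quadratic case covers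
both the Newton model and the proximal model below.
\<close>

lemma argmin_strong_support:
  assumes v: "v \<in> Q"
    and min: "\<And>y. y \<in> Q \<Longrightarrow> q v + p v \<le> q y + p y"
    and quad: "\<And>h. h \<in> Rn n \<Longrightarrow> \<exists>c. \<forall>t. q (v + t *\<^sub>R h) = q v + t * scp n s h + t\<^sup>2 * c"
    and y: "y \<in> Q"
  shows "p v - scp n s (y - v) + \<mu> / 2 * (N (y - v))\<^sup>2 \<le> p y"
proof -
  have support: "p v - scp n s (y - v) \<le> p y" if y: "y \<in> Q" for y
  proof -
    obtain c where c: "\<And>t. q (v + t *\<^sub>R (y - v)) = q v + t * scp n s (y - v) + t\<^sup>2 * c"
      using quad[of "y - v"] v y by (auto simp: Rn_intros Q_Rn)
    have small: "p v \<le> p y + scp n s (y - v) + t * c" if t: "0 < t" "t \<le> 1" for t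
    proof -
      have "q v + p v \<le> q (v + t *\<^sub>R (y - v)) + p (v + t *\<^sub>R (y - v))"
        using p_convex(1)[OF v y, of t] t by (intro min) auto
      also have "p (v + t *\<^sub>R (y - v)) \<le> (1 - t) * p v + t * p y"
        using p_convex(2)[OF v y, of t] t by auto
      finally have "t * p v \<le> t * (p y + scp n s (y - v) + t * c)"
        unfolding c by (simp add: algebra_simps power2_eq_square)
      then show ?thesis using t by simp
    qed
    have "p v \<le> p y + scp n s (y - v) + e" if e: "0 < e" for e
    proof -
      define t where "t = min 1 (e / (\<bar>c\<bar> + 1))"
      have t: "0 < t" "t \<le> 1" "t \<le> e / (\<bar>c\<bar> + 1)"
        using e by (auto simp: t_def)
      then have "t * (\<bar>c\<bar> + 1) \<le> e"
        by (simp add: pos_le_divide_eq)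
      moreover have "t * c \<le> t * (\<bar>c\<bar> + 1)" using t by (intro mult_left_mono) auto
      ultimately show ?thesis using small[OF t(1,2)] by linarith
    qed
    then have "p v \<le> p y + scp n s (y - v)" by (rule field_le_epsilon)
    then show ?thesis by simp
  qed
  have "\<psi> v + ereal (scp n (\<lambda>i. - s i) (y - v)) \<le> \<psi> y" if "y \<in> Rn n" for y
    using support[of y] psi_infinite[OF that] v
    by (cases "y \<in> Q") (auto simp: psi_real scp_minus_left)
  then have "(\<lambda>i. - s i) \<in> subdifferential n \<psi> v"
    by (simp add: subdifferential_def)
  then have "\<psi> v + ereal (scp n (\<lambda>i. - s i) (y - v) + \<mu> / 2 * (N (y - v))\<^sup>2) \<le> \<psi> y"
    using strongly_convex v y unfolding strongly_convex_def by blast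
  then show ?thesis
    using v y by (simp add: psi_real scp_minus_left)
qed

section \<open>Strong convexity along segments\<close>

text \<open>
Existence of a proximal point. The epigraph form turns the minimisation of a lower semicontinuous
function into that of a continuous one over a compact piece of the closed epigraph.
\<close>

lemma prox_exists:
  assumes z: "z \<in> Q" and c: "0 \<le> c"
  shows "\<exists>y\<in>Q. \<forall>w\<in>Q. c * sqnorm n (y - z) + p y \<le> c * sqnorm n (w - z) + p w"
proof -
  obtain K where K: "compact K" "Q \<subseteq> K" using Q_in_compact by blast
  obtain L where L: "\<And>y. y \<in> Q \<Longrightarrow> L \<le> p y" using p_bounded_below by blast
  define E where "E = (K \<times> {L..p z}) \<inter> epi n \<psi>"
  have compact: "compact E"
    unfolding E_def by (intro compact_Int_closed compact_Times K closed_epi) auto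
  have E_iff: "(y, t) \<in> E \<longleftrightarrow> y \<in> Q \<and> p y \<le> t \<and> t \<le> p z" for y t
    using K(2) L[of y] by (auto simp: E_def mem_epi_iff)
  have "(z, p z) \<in> E" using z by (simp add: E_iff)
  have "continuous_on E (\<lambda>(y, t). c * sqnorm n (y - z) + t)"
  proof -
    have "continuous_on E (\<lambda>x. sqnorm n (fst x - z))"
      by (rule continuous_on_compose2[OF continuous_on_sqnorm[of UNIV]]) (auto intro!: continuous_intros)
    then show ?thesis
      unfolding case_prod_unfold by (intro continuous_intros)
  qed
  then obtain y t where yt: "(y, t) \<in> E"
    and min: "\<And>w s. (w, s) \<in> E \<Longrightarrow> c * sqnorm n (y - z) + t \<le> c * sqnorm n (w - z) + s"
    using continuous_attains_inf[OF compact, of "\<lambda>(y, t). c * sqnorm n (y - z) + t"] \<open>(z, p z) \<in> E\<close>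
    by fastforce
  have "c * sqnorm n (y - z) + p y \<le> c * sqnorm n (w - z) + p w" if "w \<in> Q" for w
  proof (cases "p w \<le> p z")
    case True
    then have "(w, p w) \<in> E" using that by (simp add: E_iff)
    from min[OF this] yt show ?thesis by (simp add: E_iff)
  next
    case False
    have "sqnorm n (z - z) = 0" by (simp add: sqnorm_def scp_right)
    then have "c * sqnorm n (y - z) + t \<le> p z"
      using min[OF \<open>(z, p z) \<in> E\<close>] by simp
    moreover have "0 \<le> c * sqnorm n (w - z)" using c sqnorm_nonneg by simp
    ultimately show ?thesis using yt False by (simp add: E_iff)
  qed
  then show ?thesis using yt by (auto simp: E_iff)
qed

text \<open>
The interpolation point may lie on the boundary of the domain and have no subgradient there.
Proximal points of it do have subgradients, and they approach it as the regularisation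
weight grows. At a proximal point \<open>y\<close> of \<open>z\<close> the subgradient is a positive multiple of \<open>z - y\<close>, hence
has a nonnegative product with \<open>z - y\<close>; adding the two strong support inequalities towards \<open>x\<close> and
\<open>v\<close> gives the claim up to the position of \<open>y\<close>. Closedness of the epigraph passes it to the limit.
\<close>

lemma strong_jensen:
  assumes x: "x \<in> Q" and v: "v \<in> Q" and c: "0 \<le> c" "c \<le> 1"
  shows "p (x + c *\<^sub>R (v - x)) \<le> (1 - c) * p x + c * p v - \<mu> / 2 * (c * (1 - c)) * (N (v - x))\<^sup>2"
proof -
  define z where "z = x + c *\<^sub>R (v - x)"
  have z: "z \<in> Q" unfolding z_def using assms by (intro p_convex)
  obtain L where L: "\<And>y. y \<in> Q \<Longrightarrow> L \<le> p y" using p_bounded_below by blast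
  have "\<exists>y\<in>Q. \<forall>w\<in>Q. real (Suc m) * sqnorm n (y - z) + p y \<le> real (Suc m) * sqnorm n (w - z) + p w" for m
    by (rule prox_exists[OF z]) simp
  then obtain Y where Y: "\<And>m. Y m \<in> Q"
    and Ymin: "\<And>m w. w \<in> Q \<Longrightarrow>
       real (Suc m) * sqnorm n (Y m - z) + p (Y m) \<le> real (Suc m) * sqnorm n (w - z) + p w"
    by metis
  define J where "J y = (1 - c) * p x + c * p v
     - \<mu> / 2 * ((1 - c) * (N (x - y))\<^sup>2 + c * (N (v - y))\<^sup>2)" for y
  \<comment> \<open>\<open>J z\<close> equals the right-hand side of the claim, and \<open>J\<close> is continuous.\<close>
  have below: "p (Y m) \<le> J (Y m)" for m
  proof -
    define s where "s = (\<lambda>i. 2 * real (Suc m) * apply_bcontfun (Y m - z) i)"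
    have quad: "\<exists>b. \<forall>t. real (Suc m) * sqnorm n (Y m + t *\<^sub>R h - z)
        = real (Suc m) * sqnorm n (Y m - z) + t * scp n s h + t\<^sup>2 * b" for h
    proof (intro exI allI)
      fix t
      have "sqnorm n (Y m + t *\<^sub>R h - z)
          = sqnorm n (Y m - z) + t * (2 * scp n (apply_bcontfun (Y m - z)) h) + t\<^sup>2 * sqnorm n h"
        by (simp add: sqnorm_def scp_def algebra_simps sum.distrib sum_subtractf sum_distrib_left
            power2_eq_square plus_bcontfun.rep_eq minus_bcontfun.rep_eq scaleR_bcontfun.rep_eq)
      then show "real (Suc m) * sqnorm n (Y m + t *\<^sub>R h - z)
        = real (Suc m) * sqnorm n (Y m - z) + t * scp n s h + t\<^sup>2 * (real (Suc m) * sqnorm n h)"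
        unfolding s_def scp_scale_left by (simp add: algebra_simps)
    qed
    have support: "p (Y m) - scp n s (y - Y m) + \<mu> / 2 * (N (y - Y m))\<^sup>2 \<le> p y" if "y \<in> Q" for y
      using argmin_strong_support[of "Y m" "\<lambda>y. real (Suc m) * sqnorm n (y - z)", OF Y Ymin quad that] .
    let ?a = "(N (x - Y m))\<^sup>2" and ?b = "(N (v - Y m))\<^sup>2"
    have "(1 - c) * (p (Y m) - scp n s (x - Y m) + \<mu> / 2 * ?a)
        + c * (p (Y m) - scp n s (v - Y m) + \<mu> / 2 * ?b) \<le> (1 - c) * p x + c * p v"
      using c by (intro add_mono mult_left_mono support x v) auto
    moreover have combine: "(1 - c) * (P - s1 + \<mu> / 2 * a) + c * (P - s2 + \<mu> / 2 * b)
        = P - ((1 - c) * s1 + c * s2) + \<mu> / 2 * ((1 - c) * a + c * b)" for P s1 s2 a b :: real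
      by (simp add: field_simps)
    ultimately have "p (Y m) - ((1 - c) * scp n s (x - Y m) + c * scp n s (v - Y m))
        + \<mu> / 2 * ((1 - c) * ?a + c * ?b) \<le> (1 - c) * p x + c * p v"
      by (simp only: combine)
    moreover have "(1 - c) * scp n s (x - Y m) + c * scp n s (v - Y m) = scp n s (z - Y m)"
      by (simp add: z_def scp_right algebra_simps)
    moreover have "scp n s (z - Y m) = - (2 * real (Suc m) * sqnorm n (Y m - z))"
      unfolding s_def scp_scale_left sqnorm_def by (simp add: scp_right algebra_simps)
    moreover have "0 \<le> 2 * real (Suc m) * sqnorm n (Y m - z)" by (simp add: sqnorm_nonneg)
    ultimately show ?thesis unfolding J_def by linarith
  qed
  have near: "norm (Y m - z) \<le> sqrt ((p z - L) * inverse (real (Suc m)))" for m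
  proof -
    have "real (Suc m) * sqnorm n (Y m - z) \<le> p z - L"
      using Ymin[OF z, of m] L[OF Y, of m] by (simp add: sqnorm_def scp_right)
    then have "sqnorm n (Y m - z) \<le> (p z - L) * inverse (real (Suc m))"
      by (simp add: field_simps)
    then show ?thesis
      using norm_le_sqrt_sqnorm[of "Y m - z"] Y z
      by (meson Q_Rn Rn_diff order_trans real_sqrt_le_mono)
  qed
  have "(\<lambda>m. sqrt ((p z - L) * inverse (real (Suc m)))) \<longlonglongrightarrow> sqrt ((p z - L) * 0)"
    by (intro tendsto_intros LIMSEQ_inverse_real_of_nat)
  then have "(\<lambda>m. norm (Y m - z)) \<longlonglongrightarrow> 0"
    using near by (intro Lim_null_comparison[of "\<lambda>m. norm (Y m - z)"]) auto
  then have lim: "Y \<longlonglongrightarrow> z"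
    using LIM_zero_cancel tendsto_norm_zero_iff by blast
  have limN: "(\<lambda>m. N (b - Y m)) \<longlonglongrightarrow> N (b - z)" if "b \<in> Q" for b
    using that Y z lim
    by (intro continuous_on_tendsto_compose[OF continuous_on_N[OF is_norm]])
       (auto intro!: tendsto_intros simp: Rn_diff Q_Rn)
  have lim_epi: "(\<lambda>m. (Y m, J (Y m))) \<longlonglongrightarrow> (z, J z)"
    unfolding J_def using x v lim by (intro tendsto_intros limN)
  have in_epi: "(Y m, J (Y m)) \<in> epi n \<psi>" for m
    using below Y by (simp add: mem_epi_iff)
  have "(z, J z) \<in> epi n \<psi>"
    by (rule closed_sequentially[OF closed_epi in_epi lim_epi])
  then have "p z \<le> J z" by (simp add: mem_epi_iff)
  moreover have Nx: "N (x - z) = c * N (v - x)"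
    using N_scale[OF is_norm, of "v - x" "- c"] x v c by (simp add: z_def Rn_intros Q_Rn algebra_simps)
  moreover have Nv: "N (v - z) = (1 - c) * N (v - x)"
  proof -
    have "v - z = (1 - c) *\<^sub>R (v - x)" by (simp add: z_def algebra_simps)
    then show ?thesis using x v c by (simp add: N_simps Rn_intros Q_Rn)
  qed
  moreover have "J z = (1 - c) * p x + c * p v - \<mu> / 2 * (c * (1 - c)) * (N (v - x))\<^sup>2"
    unfolding J_def Nx Nv by (simp add: power2_eq_square field_simps)
  ultimately show ?thesis by (simp add: z_def)
qed

end

section \<open>First-order estimates for the smooth part\<close>

lemma hpow_nonneg: "0 \<le> hpow t a"
  by (simp add: hpow_def)

lemma hpow_mono: "0 \<le> a \<Longrightarrow> 0 \<le> s \<Longrightarrow> s \<le> t \<Longrightarrow> hpow s a \<le> hpow t a"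
  by (simp add: hpow_def powr_mono2)

lemma hpow_mult: "0 < s \<Longrightarrow> 0 \<le> t \<Longrightarrow> hpow (s * t) a = s powr a * hpow t a"
  by (simp add: hpow_def powr_mult)

context strongly_convex_composite
begin

text \<open>
The domain need not have interior points, so the tangent inequality is derived from one-sided
difference quotients along the segment.
\<close>

lemma f_above_tangent:
  assumes x: "x \<in> Q" and y: "y \<in> Q"
  shows "f x + scp n (g x) (y - x) \<le> f y"
proof -
  define \<phi> where "\<phi> t = f (x + t *\<^sub>R (y - x))" for t
  have "(f has_derivative scp n (g x)) (at (x + 0 *\<^sub>R (y - x)) within Rn n)"
    using C2_atD(1)[OF f_C2[OF x] Q_Rn[OF x]] by simp
  from has_derivative_along_line[OF this] have "(\<phi> has_real_derivative scp n (g x) (y - x)) (at 0)"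
    using x y unfolding \<phi>_def by (simp add: Q_Rn Rn_intros)
  then have "((\<lambda>t. (\<phi> t - \<phi> 0) / t) \<longlongrightarrow> scp n (g x) (y - x)) (at 0)"
    by (simp add: has_field_derivative_iff)
  then have lim: "((\<lambda>t. (\<phi> t - \<phi> 0) / t) \<longlongrightarrow> scp n (g x) (y - x)) (at_right 0)"
    by (rule tendsto_within_subset) simp
  have "\<forall>\<^sub>F t in at_right 0. (\<phi> t - \<phi> 0) / t \<le> f y - f x"
  proof (rule eventually_at_rightI[of 0 1])
    fix t :: real assume t: "t \<in> {0<..<1}"
    have "f ((1 - t) *\<^sub>R x + t *\<^sub>R y) \<le> (1 - t) * f x + t * f y"
      using t x y by (intro convex_onD[OF f_convex]) auto
    moreover have "(1 - t) *\<^sub>R x + t *\<^sub>R y = x + t *\<^sub>R (y - x)" by (simp add: algebra_simps)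
    ultimately have "\<phi> t - \<phi> 0 \<le> t * (f y - f x)" by (simp add: \<phi>_def algebra_simps)
    then show "(\<phi> t - \<phi> 0) / t \<le> f y - f x" using t by (simp add: field_simps)
  qed simp
  then have "scp n (g x) (y - x) \<le> f y - f x"
    using tendsto_upperbound[OF lim] by simp
  then show ?thesis by simp
qed

definition taylor_error :: "real \<Rightarrow> real" where
  "taylor_error d = H / (1 + \<nu>) * hpow d \<nu> * d"

text \<open>
Along the segment from \<open>x\<close> to \<open>y\<close> the gradient changes at a rate that differs from the Hessian
form at \<open>x\<close> by at most \<open>H t\<^sup>\<nu> d\<^sup>\<nu>\<^sup>+\<^sup>1\<close> times the size of \<open>u\<close>. Comparison with a primitive of this bound
replaces integration.
\<close>

lemma gradient_taylor_bound:
  assumes x: "x \<in> Q" and y: "y \<in> Q" and u: "u \<in> Rn n"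
  shows "scp n (g y) u - scp n (g x) u - bilin n (Hs x) (y - x) u \<le> taylor_error (N (y - x)) * N u"
proof -
  define d where "d = N (y - x)"
  define z where "z t = x + t *\<^sub>R (y - x)" for t
  have d: "0 \<le> d" unfolding d_def by (rule N_le_diam[OF y x])
  have Nu: "0 \<le> N u" using u by (simp add: N_simps)
  have yx: "y - x \<in> Rn n" using x y by (simp add: Rn_intros Q_Rn)
  have z: "z t \<in> Q" if "0 \<le> t" "t \<le> 1" for t
    unfolding z_def using p_convex(1)[OF x y that] .
  define K where "K = H / (1 + \<nu>) * hpow d \<nu> * d * N u"
  have K: "K * (1 + \<nu>) = H * hpow d \<nu> * d * N u" using nu by (simp add: K_def)
  define B where "B t = K * t powr (1 + \<nu>)" for t
  define \<theta> where "\<theta> t = B t - (scp n (g (z t)) u - t * bilin n (Hs x) (y - x) u)" for t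
  have der_g: "((\<lambda>t. scp n (g (z t)) u) has_real_derivative bilin n (Hs (z t)) (y - x) u) (at t)"
    if t: "0 \<le> t" "t \<le> 1" for t
  proof -
    have "((\<lambda>w. scp n (g w) u) has_derivative (\<lambda>h. bilin n (Hs (z t)) h u)) (at (x + t *\<^sub>R (y - x)) within Rn n)"
      using C2_atD(2)[OF f_C2[OF z[OF t]] Q_Rn[OF z[OF t]], of u] by (simp add: z_def)
    from has_derivative_along_line[OF this Q_Rn[OF x] yx] show ?thesis
      by (simp add: z_def)
  qed
  have "\<theta> 0 \<le> \<theta> 1"
  proof (rule DERIV_nonneg_imp_increasing_open[of 0 1 \<theta>])
    fix t :: real assume t: "0 < t" "t < 1"
    have "(B has_real_derivative K * ((1 + \<nu>) * t powr \<nu>)) (at t)"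
      using DERIV_cmult[OF has_real_derivative_powr[OF t(1), of "1 + \<nu>"], of K]
      unfolding B_def by simp
    then have der_B: "(B has_real_derivative H * hpow d \<nu> * d * N u * t powr \<nu>) (at t)"
      unfolding K[symmetric] by (simp only: mult.assoc)
    have "(\<theta> has_real_derivative H * hpow d \<nu> * d * N u * t powr \<nu>
        - (bilin n (Hs (z t)) (y - x) u - 1 * bilin n (Hs x) (y - x) u)) (at t)"
      unfolding \<theta>_def using t
      by (intro DERIV_diff[OF der_B DERIV_diff[OF der_g DERIV_cmult_right[OF DERIV_ident]]]) auto
    moreover have "bilin n (Hs (z t)) (y - x) u - bilin n (Hs x) (y - x) u
        \<le> H * hpow d \<nu> * d * N u * t powr \<nu>"
    proof -
      have "N (z t - x) = t * d"
        using t yx by (simp add: z_def d_def N_simps)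
      then have "mat_norm n N (\<lambda>i j. Hs (z t) i j - Hs x i j) \<le> H * (t powr \<nu> * hpow d \<nu>)"
        using Hoelder[OF z x, of t] t d by (simp add: hpow_mult)
      then have "mat_norm n N (\<lambda>i j. Hs (z t) i j - Hs x i j) * d * N u
          \<le> H * (t powr \<nu> * hpow d \<nu>) * d * N u"
        using d Nu by (intro mult_right_mono)
      with bilin_le_mat_norm[OF is_norm yx u, of "\<lambda>i j. Hs (z t) i j - Hs x i j"]
      show ?thesis
        unfolding d_def[symmetric] bilin_matrix_diff by (simp add: mult_ac)
    qed
    ultimately show "\<exists>D. (\<theta> has_real_derivative D) (at t) \<and> 0 \<le> D"
      by (intro exI conjI) auto
  next
    have "continuous_on {0..1} (\<lambda>t. scp n (g (z t)) u)"
      using der_g by (intro DERIV_continuous_on[where D = "\<lambda>t. bilin n (Hs (z t)) (y - x) u"])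
        (auto intro: has_field_derivative_at_within)
    moreover have "continuous_on {0..1} B"
      unfolding B_def using nu by (intro continuous_intros continuous_on_powr') auto
    ultimately show "continuous_on {0..1} \<theta>"
      unfolding \<theta>_def by (intro continuous_intros)
  qed simp
  then show ?thesis
    by (simp add: \<theta>_def B_def K_def z_def taylor_error_def d_def)
qed

section \<open>One Newton step\<close>

text \<open>
The net progress of a step with coefficient \<open>c\<close>, where \<open>d\<close> is the distance from the iterate to the
Newton point \<open>v\<close> and \<open>e\<close> the distance from \<open>v\<close> to the comparison point: both quadratic terms come from
strong convexity, the subtracted term is the error of linearising the gradient.
\<close>

definition gain :: "real \<Rightarrow> real \<Rightarrow> real \<Rightarrow> real" where
  "gain c d e = \<mu> / 2 * ((1 - c) * d\<^sup>2 + e\<^sup>2) - taylor_error (c * d) * e"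

lemma newton_step:
  assumes x: "x \<in> Q" and c: "0 < c" "c \<le> 1"
    and argmin: "is_arg_min (newton_model n g Hs \<psi> c x) (\<lambda>y. y \<in> Rn n) v"
  shows "v \<in> Q"
    and "y \<in> Q \<Longrightarrow> p v - (scp n (g x) (y - v) + c * bilin n (Hs x) (v - x) (y - v))
           + \<mu> / 2 * (N (y - v))\<^sup>2 \<le> p y"
proof -
  define q where "q y = scp n (g x) (y - x) + c / 2 * bilin n (Hs x) (y - x) (y - x)" for y
  have model: "newton_model n g Hs \<psi> c x y = ereal (q y) + \<psi> y" for y
    by (simp add: newton_model_def q_def bilin_def)
  have v_Rn: "v \<in> Rn n" and min: "\<And>y. y \<in> Rn n \<Longrightarrow> ereal (q v) + \<psi> v \<le> ereal (q y) + \<psi> y"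
    using argmin by (auto simp: is_arg_min_def model not_less)
  show v: "v \<in> Q"
  proof (rule ccontr)
    assume "v \<notin> Q"
    then have "\<psi> v = \<infinity>" using v_Rn psi_infinite by simp
    then show False using min[of x] x by (simp add: Q_Rn psi_real)
  qed
  show "p v - (scp n (g x) (y - v) + c * bilin n (Hs x) (v - x) (y - v))
           + \<mu> / 2 * (N (y - v))\<^sup>2 \<le> p y" if y: "y \<in> Q"
  proof -
    define s where "s = (\<lambda>i. g x i + c * mat_app n (Hs x) (v - x) i)"
    have s: "scp n s h = scp n (g x) h + c * bilin n (Hs x) (v - x) h" for h
      by (simp add: s_def scp_add_left scp_scale_left bilin_def)
    have "p v - scp n s (y - v) + \<mu> / 2 * (N (y - v))\<^sup>2 \<le> p y"
    proof (rule argmin_strong_support[OF v _ _ y, of q])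
      show "q v + p v \<le> q w + p w" if "w \<in> Q" for w
        using min[of w] that v by (simp add: psi_real Q_Rn)
      show "\<exists>b. \<forall>t. q (v + t *\<^sub>R h) = q v + t * scp n s h + t\<^sup>2 * b" if h: "h \<in> Rn n" for h
      proof (intro exI allI)
        fix t
        have "bilin n (Hs x) h (v - x) = bilin n (Hs x) (v - x) h"
          using hessian_symmetric[OF f_C2[OF x] Q_Rn[OF x] h, of "v - x"] v x
          by (simp add: Rn_intros Q_Rn)
        moreover have "v + t *\<^sub>R h - x = (v - x) + t *\<^sub>R h" by simp
        ultimately show "q (v + t *\<^sub>R h) = q v + t * scp n s h + t\<^sup>2 * (c / 2 * bilin n (Hs x) h h)"
          unfolding q_def s by (simp only: scp_right(1,3) bilin_left(1,3) bilin_right(1,3))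
            (simp add: field_simps power2_eq_square)
      qed
    qed
    then show ?thesis by (simp only: s)
  qed
qed

text \<open>
Averaging the tangent inequality of \<open>f\<close> at the new point with weights \<open>1 - c\<close> and \<open>c\<close> leaves the
gradient at \<open>x'\<close> in direction \<open>y - v\<close> only. There it agrees, up to the Taylor error, with the model
gradient, and optimality of \<open>v\<close> bounds the latter, with the term in \<open>e\<^sup>2\<close> to spare. The term in \<open>d\<^sup>2\<close> is
the strong convexity gained when \<open>\<psi>(x)\<close> and \<open>\<psi>(v)\<close> are merged into \<open>\<psi>(x')\<close>.
\<close>

lemma newton_step_progress:
  assumes x: "x \<in> Q" and c: "0 < c" "c \<le> 1"
    and argmin: "is_arg_min (newton_model n g Hs \<psi> c x) (\<lambda>y. y \<in> Rn n) v"
    and x': "x' = x + c *\<^sub>R (v - x)" and y: "y \<in> Q"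
  shows "f x' + p x' + c * gain c (N (v - x)) (N (y - v))
    \<le> (1 - c) * (f x + p x) + c * (f x' + scp n (g x') (y - x') + p y)"
proof -
  define d where "d = N (v - x)"
  define e where "e = N (y - v)"
  note v = newton_step(1)[OF x c argmin]
  have x'Q: "x' \<in> Q" unfolding x' using c by (intro p_convex x v) auto
  have tangent: "(1 - c) * (f x' + scp n (g x') (x - x')) \<le> (1 - c) * f x"
    using c by (intro mult_left_mono f_above_tangent x'Q x) auto
  have "scp n (g x') (v - y) - scp n (g x) (v - y) - bilin n (Hs x) (x' - x) (v - y)
      \<le> taylor_error (N (x' - x)) * N (v - y)"
    using v y by (intro gradient_taylor_bound x x'Q) (simp add: Rn_intros Q_Rn)
  moreover have "N (x' - x) = c * d"
    using c v x by (simp add: x' d_def N_simps Rn_intros Q_Rn)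
  moreover have "N (v - y) = e"
    unfolding e_def using v y by (intro N_minus_commute[OF is_norm] Q_Rn)
  moreover have "bilin n (Hs x) (x' - x) w = c * bilin n (Hs x) (v - x) w" for w
    by (simp add: x' bilin_left)
  moreover have "scp n s (v - y) = - scp n s (y - v)" for s
    by (simp add: scp_right)
  moreover have "bilin n (Hs x) w (v - y) = - bilin n (Hs x) w (y - v)" for w
    by (simp add: bilin_right)
  ultimately have taylor: "scp n (g x) (y - v) + c * bilin n (Hs x) (v - x) (y - v) - taylor_error (c * d) * e
      \<le> scp n (g x') (y - v)"
    by simp
  note opt = newton_step(2)[OF x c argmin y, folded e_def]
  have "c * (p v + \<mu> / 2 * e\<^sup>2 - taylor_error (c * d) * e) \<le> c * (scp n (g x') (y - v) + p y)"
    using taylor opt c by (intro mult_left_mono) auto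
  moreover have "p x' \<le> (1 - c) * p x + c * p v - \<mu> / 2 * (c * (1 - c)) * d\<^sup>2"
    unfolding x' d_def using c by (intro strong_jensen x v) auto
  moreover have "c * scp n (g x') (y - v) = (1 - c) * scp n (g x') (x - x') + c * scp n (g x') (y - x')"
  proof -
    have "c *\<^sub>R (y - v) = (1 - c) *\<^sub>R (x - x') + c *\<^sub>R (y - x')"
      by (simp add: x' algebra_simps)
    then have "scp n (g x') (c *\<^sub>R (y - v)) = scp n (g x') ((1 - c) *\<^sub>R (x - x') + c *\<^sub>R (y - x'))"
      by (rule arg_cong)
    then show ?thesis by (simp only: scp_right(1,3) real_scaleR_def)
  qed
  moreover have "(1 - c) * (fx + px) + c * (f' + s2 + py)
      - (f' + p' + c * (\<mu> / 2 * ((1 - c) * d\<^sup>2 + e\<^sup>2) - T * e))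
    = ((1 - c) * fx - (1 - c) * (f' + s1)) + (c * (s3 + py) - c * (pv + \<mu> / 2 * e\<^sup>2 - T * e))
      + ((1 - c) * px + c * pv - \<mu> / 2 * (c * (1 - c)) * d\<^sup>2 - p') + ((1 - c) * s1 + c * s2 - c * s3)"
    for fx px f' p' s1 s2 s3 py pv T :: real
    by (simp add: field_simps)
  note identity = this[of "f x" "p x" "f x'" "scp n (g x') (y - x')" "p y" "p x'"
    "taylor_error (c * d)" "scp n (g x') (x - x')" "scp n (g x') (y - v)" "p v"]
  ultimately have "0 \<le> (1 - c) * (f x + p x) + c * (f x' + scp n (g x') (y - x') + p y)
      - (f x' + p x' + c * (\<mu> / 2 * ((1 - c) * d\<^sup>2 + e\<^sup>2) - taylor_error (c * d) * e))"
    using tangent unfolding identity by linarith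
  then show ?thesis
    unfolding gain_def d_def[symmetric] e_def[symmetric] by simp
qed

section \<open>The gap after k steps\<close>

text \<open>
The estimating sequence argument: scaled by the weights, the one-step inequality telescopes to
\<open>A\<^sub>k F(x\<^sub>k) - \<Sum> a\<^sub>i \<epsilon>\<^sub>i \<le> \<phi>\<^sub>k\<close> with whatever amounts \<open>\<epsilon>\<^sub>i\<close> the gain may fall below zero. Points outside
the domain do no harm because \<open>\<phi>\<^sub>k\<close> is infinite there. The bound on \<open>F(x\<^sub>k) - F\<^sup>*\<close> only expresses
that \<open>\<phi>\<^sub>k\<close> lies below \<open>A\<^sub>k F\<close>.
\<close>

lemma gap_bound:
  assumes run: "CDN_run n g Hs \<psi> \<gamma> x"
    and step: "\<And>k. \<gamma> k = step_coef A k"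
    and A0: "A 0 = 0" and A_mono: "\<And>k. A k < A (Suc k)"
    and loss: "\<And>i d e. 0 \<le> d \<Longrightarrow> d \<le> D \<Longrightarrow> 0 \<le> e \<Longrightarrow> e \<le> D \<Longrightarrow> - \<epsilon> i \<le> gain (\<gamma> i) d e"
    and k: "k \<ge> 1"
  shows "objective f \<psi> (x k) - opt_value n f \<psi> \<le> gap n f g \<psi> A x k"
    and "gap n f g \<psi> A x k \<le> ereal ((\<Sum>i<k. (A (Suc i) - A i) * \<epsilon> i) / A k)"
proof -
  obtain v where v: "\<And>k. is_arg_min (newton_model n g Hs \<psi> (\<gamma> k) (x k)) (\<lambda>y. y \<in> Rn n) (v (Suc k))"
    and xS: "\<And>k. x (Suc k) = x k + \<gamma> k *\<^sub>R (v (Suc k) - x k)" and x0: "x 0 \<in> Q"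
    using run unfolding CDN_run_def by blast
  have A_nonneg: "0 \<le> A k" for k
    using A0 A_mono by (induction k) (auto intro: less_imp_le order.strict_trans1)
  have A_pos: "0 < A (Suc k)" for k
    using A_nonneg[of k] A_mono[of k] by linarith
  have gam: "0 < \<gamma> k" "\<gamma> k \<le> 1" "A (Suc k) * \<gamma> k = A (Suc k) - A k" for k
    using A_pos[of k] A_mono[of k] A_nonneg[of k] by (auto simp: step step_coef_def field_simps)
  have xQ: "x k \<in> Q" for k
  proof (induction k)
    case (Suc k)
    have "v (Suc k) \<in> Q" by (rule newton_step(1)[OF Suc gam(1,2) v])
    then show ?case unfolding xS using gam[of k] by (intro p_convex Suc) auto
  qed (rule x0)
  define F where "F y = f y + p y" for y
  define m where "m k y = (\<Sum>i=1..k. (A i - A (i - 1)) * (f (x i) + scp n (g (x i)) (y - x i) + p y))" for k y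
  have m_upper: "m k y \<le> A k * F y" if y: "y \<in> Q" for y k
  proof -
    have "m k y \<le> (\<Sum>i=1..k. (A i - A (i - 1)) * F y)"
      unfolding m_def
    proof (rule sum_mono)
      fix i assume "i \<in> {1..k}"
      then have "0 \<le> A i - A (i - 1)" using A_mono[of "i - 1"] by simp
      then show "(A i - A (i - 1)) * (f (x i) + scp n (g (x i)) (y - x i) + p y) \<le> (A i - A (i - 1)) * F y"
        unfolding F_def by (intro mult_left_mono add_right_mono f_above_tangent xQ y)
    qed
    also have "\<dots> = A k * F y"
    proof (induction k)
      case (Suc k)
      then show ?case by (simp add: algebra_simps)
    qed (simp add: A0)
    finally show ?thesis .
  qed
  have m_lower: "A k * F (x k) - (\<Sum>i<k. (A (Suc i) - A i) * \<epsilon> i) \<le> m k y" if y: "y \<in> Q" for y k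
  proof (induction k)
    case 0
    then show ?case by (simp add: m_def A0)
  next
    case (Suc k)
    let ?t = "f (x (Suc k)) + scp n (g (x (Suc k))) (y - x (Suc k)) + p y"
    have vQ: "v (Suc k) \<in> Q" by (rule newton_step(1)[OF xQ gam(1,2) v])
    have "- \<epsilon> k \<le> gain (\<gamma> k) (N (v (Suc k) - x k)) (N (y - v (Suc k)))"
      using vQ xQ y by (intro loss N_le_diam)
    then have "F (x (Suc k)) - \<gamma> k * \<epsilon> k \<le> F (x (Suc k)) + \<gamma> k * gain (\<gamma> k) (N (v (Suc k) - x k)) (N (y - v (Suc k)))"
      using mult_left_mono[of "- \<epsilon> k" _ "\<gamma> k"] gam(1)[of k] by simp
    also have "\<dots> \<le> (1 - \<gamma> k) * F (x k) + \<gamma> k * ?t"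
      using newton_step_progress[OF xQ gam(1,2) v xS y] by (simp add: F_def)
    finally have "A (Suc k) * (F (x (Suc k)) - \<gamma> k * \<epsilon> k) \<le> A (Suc k) * ((1 - \<gamma> k) * F (x k) + \<gamma> k * ?t)"
      using A_pos[of k] by (intro mult_left_mono) auto
    moreover have "A (Suc k) * (F (x (Suc k)) - \<gamma> k * \<epsilon> k) = A (Suc k) * F (x (Suc k)) - (A (Suc k) * \<gamma> k) * \<epsilon> k"
      "A (Suc k) * ((1 - \<gamma> k) * F (x k) + \<gamma> k * ?t) = (A (Suc k) - A (Suc k) * \<gamma> k) * F (x k) + (A (Suc k) * \<gamma> k) * ?t"
      by (simp_all add: algebra_simps)
    moreover have "m (Suc k) y = m k y + (A (Suc k) - A k) * ?t"
      by (simp add: m_def)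
    ultimately show ?case
      using Suc unfolding gam(3) by simp
  qed
  have lower_model_Q: "lower_model n f g \<psi> A x k y = ereal (m k y)" if "y \<in> Q" for y
    using that by (simp add: lower_model_def m_def psi_real)
  have lower_model_infinite: "lower_model n f g \<psi> A x k y = \<infinity>" if "y \<in> Rn n" "y \<notin> Q" for y
  proof -
    have "0 < A 1 - A (1 - 1)" using A_mono[of 0] by simp
    then have "ereal (A 1 - A (1 - 1)) * (ereal (f (x 1) + scp n (g (x 1)) (y - x 1)) + \<psi> y) = \<infinity>"
      by (simp add: psi_infinite[OF that])
    then show ?thesis
      unfolding lower_model_def sum_Pinfty using k
      by (intro conjI bexI[of _ "1::nat"]) auto
  qed
  have Ak: "0 < A k" using A_pos[of "k - 1"] k by simp
  let ?inf = "INF y\<in>Rn n. lower_model n f g \<psi> A x k y"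
  have obj: "objective f \<psi> (x k) = ereal (F (x k))"
    using xQ by (simp add: objective_def F_def psi_real)
  have "?inf / ereal (A k) \<le> objective f \<psi> y" if y: "y \<in> Rn n" for y
  proof (cases "y \<in> Q")
    case True
    have "?inf \<le> ereal (m k y)"
      using y lower_model_Q[OF True] by (metis INF_lower)
    also have "\<dots> \<le> ereal (A k * F y)" using m_upper[OF True] by simp
    finally have "?inf / ereal (A k) \<le> ereal (A k * F y) / ereal (A k)"
      using Ak by (intro ereal_divide_right_mono) auto
    also have "\<dots> = objective f \<psi> y"
      using Ak True by (simp add: objective_def F_def psi_real)
    finally show ?thesis .
  next
    case False
    then show ?thesis using psi_infinite[OF y] by (simp add: objective_def)
  qed
  then have "?inf / ereal (A k) \<le> opt_value n f \<psi>"
    unfolding opt_value_def by (rule INF_greatest)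
  then show "objective f \<psi> (x k) - opt_value n f \<psi> \<le> gap n f g \<psi> A x k"
    unfolding gap_def by (intro ereal_minus_mono) auto
  let ?S = "\<Sum>i<k. (A (Suc i) - A i) * \<epsilon> i"
  have "ereal (A k * F (x k) - ?S) \<le> ?inf"
  proof (rule INF_greatest)
    fix y assume "y \<in> Rn n"
    then show "ereal (A k * F (x k) - ?S) \<le> lower_model n f g \<psi> A x k y"
      by (cases "y \<in> Q") (simp_all add: lower_model_Q lower_model_infinite m_lower)
  qed
  then have "ereal (A k * F (x k) - ?S) / ereal (A k) \<le> ?inf / ereal (A k)"
    using Ak by (intro ereal_divide_right_mono) auto
  then have "gap n f g \<psi> A x k \<le> ereal (F (x k)) - ereal (A k * F (x k) - ?S) / ereal (A k)"
    unfolding gap_def obj by (intro ereal_minus_mono) auto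
  also have "\<dots> = ereal (?S / A k)"
    using Ak by (simp add: field_simps)
  finally show "gap n f g \<psi> A x k \<le> ereal (?S / A k)" .
qed

section \<open>Lower bounds for the gain\<close>

lemma D_nonneg: "0 \<le> D"
proof -
  obtain z where "z \<in> Q" using proper by (auto simp: proper_closed_convex_def)
  then show ?thesis using N_le_diam[of z z] by simp
qed

lemma diam_powr: "D powr (2 + \<nu>) = hpow D \<nu> * D\<^sup>2"
  using D_nonneg by (cases "D = 0") (auto simp: hpow_def powr_add)

lemma taylor_error_le:
  assumes "0 < c" "0 \<le> d" "d \<le> D"
  shows "taylor_error (c * d) \<le> c powr (1 + \<nu>) * (H / (1 + \<nu>) * hpow D \<nu>) * d"
proof -
  have "taylor_error (c * d) = c powr (1 + \<nu>) * (H / (1 + \<nu>) * hpow d \<nu>) * d"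
    using assms by (simp add: taylor_error_def hpow_mult powr_add)
  also have "\<dots> \<le> c powr (1 + \<nu>) * (H / (1 + \<nu>) * hpow D \<nu>) * d"
    using assms nu H by (intro mult_right_mono mult_left_mono hpow_mono) auto
  finally show ?thesis .
qed

text \<open>
For the polynomial rate only the term in \<open>e\<^sup>2\<close> is kept; completing the square turns the linear
error into one of second order in the Hessian variation, divided by \<open>\<mu>\<close>.
\<close>

lemma gain_lower_quadratic:
  assumes c: "0 < c" "c \<le> 1" and d: "0 \<le> d" "d \<le> D" and e: "0 \<le> e"
  shows "- (c powr (2 + 2 * \<nu>) * ((H * hpow D \<nu> * D)\<^sup>2 / (2 * \<mu>))) \<le> gain c d e"
proof -
  define M where "M = H * hpow D \<nu> * D"
  define T where "T = c powr (1 + \<nu>) * M"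
  have "taylor_error (c * d) \<le> c powr (1 + \<nu>) * (H / (1 + \<nu>) * hpow D \<nu>) * d"
    by (rule taylor_error_le[OF c(1) d])
  also have "\<dots> \<le> c powr (1 + \<nu>) * (H * hpow D \<nu>) * D"
  proof (intro mult_mono)
    show "H / (1 + \<nu>) \<le> H" using H nu by (simp add: divide_le_eq mult_le_cancel_left1)
  qed (use d nu H in \<open>auto simp: hpow_nonneg\<close>)
  finally have "taylor_error (c * d) * e \<le> T * e"
    using e by (intro mult_right_mono) (auto simp: T_def M_def mult_ac)
  moreover have "0 \<le> \<mu> / 2 * (e - T / \<mu>)\<^sup>2"
    using mu by simp
  moreover have "\<mu> / 2 * (e - T / \<mu>)\<^sup>2 = \<mu> / 2 * e\<^sup>2 - T * e + T\<^sup>2 / (2 * \<mu>)"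
    using mu by (simp add: power2_eq_square field_simps)
  moreover have "0 \<le> \<mu> / 2 * ((1 - c) * d\<^sup>2)"
    using mu c by simp
  moreover have "T\<^sup>2 / (2 * \<mu>) = c powr (2 + 2 * \<nu>) * (M\<^sup>2 / (2 * \<mu>))"
    using powr_add[of c "1 + \<nu>" "1 + \<nu>"] by (simp add: T_def power2_eq_square mult_ac)
  ultimately show ?thesis
    unfolding gain_def M_def[symmetric] distrib_left by linarith
qed

text \<open>
The number \<open>\<omega>\<close> is chosen such that the Taylor error at \<open>c = 1 / (1 + \<omega>)\<close> is at most \<open>\<mu> q d\<close> with
\<open>q = 1 - c = \<omega> c\<close>. Since \<open>q\<^sup>2 \<le> q\<close>, the quadratic form \<open>q d\<^sup>2 + e\<^sup>2 - 2 q d e\<close> is nonnegative, so the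
two strong convexity terms absorb the whole error.
\<close>

lemma gain_nonneg_omega:
  assumes w: "w = omega \<nu> H D \<mu>" "0 < w" and d: "0 \<le> d" "d \<le> D" and e: "0 \<le> e"
  shows "0 \<le> gain (1 / (1 + w)) d e"
proof -
  define c where "c = 1 / (1 + w)"
  have c: "0 < c" "c \<le> 1" "w * c = 1 - c" using w(2) by (auto simp: c_def field_simps)
  define z where "z = H * hpow D \<nu> / ((1 + \<nu>) * \<mu>)"
  have "0 \<le> z"
    unfolding z_def using H nu mu by (simp add: hpow_nonneg)
  then have "w powr (1 + \<nu>) = z"
    using nu unfolding w(1) omega_def z_def[symmetric] by (simp add: powr_powr)
  then have Hw: "H / (1 + \<nu>) * hpow D \<nu> = \<mu> * w powr (1 + \<nu>)"
    using mu nu by (simp add: z_def)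
  have cw: "c powr (1 + \<nu>) * w powr (1 + \<nu>) = (1 - c) powr (1 + \<nu>)"
    unfolding c(3)[symmetric] by (simp add: powr_mult)
  have "taylor_error (c * d) \<le> c powr (1 + \<nu>) * (\<mu> * w powr (1 + \<nu>)) * d"
    using taylor_error_le[OF c(1) d] by (simp only: Hw)
  also have "\<dots> = \<mu> * (1 - c) powr (1 + \<nu>) * d"
    unfolding cw[symmetric] by (simp only: mult_ac)
  also have "\<dots> \<le> \<mu> * (1 - c) * d"
  proof (intro mult_right_mono mult_left_mono)
    show "(1 - c) powr (1 + \<nu>) \<le> 1 - c"
      using powr_mono'[of 1 "1 + \<nu>" "1 - c"] c nu by simp
  qed (use mu d in auto)
  finally have "taylor_error (c * d) * e \<le> \<mu> * (1 - c) * d * e"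
    using e by (intro mult_right_mono) auto
  moreover have "0 \<le> \<mu> / 2 * (((1 - c) * d - e)\<^sup>2 + (1 - c) * c * d\<^sup>2)"
    using mu c by simp
  moreover have "\<mu> / 2 * (((1 - c) * d - e)\<^sup>2 + (1 - c) * c * d\<^sup>2)
      = \<mu> / 2 * ((1 - c) * d\<^sup>2 + e\<^sup>2) - \<mu> * (1 - c) * d * e"
    by (simp add: power2_eq_square field_simps)
  ultimately show ?thesis unfolding gain_def c_def[symmetric] by linarith
qed

end

section \<open>The two step size rules\<close>

lemma gamma_pow_eq: "gamma_pow k = step_coef A_pow k"
proof -
  have "real (Suc k) ^ 5 / real (Suc k) ^ 5 = 1" by simp
  then show ?thesis
    unfolding gamma_pow_def step_coef_def A_pow_def power_divide diff_divide_distrib Suc_eq_plus1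
    by simp
qed

lemma gamma_pow_le: "gamma_pow k \<le> 5 / real (Suc k)"
proof -
  have "1 + real 5 * (- (1 / real (Suc k))) \<le> (1 + - (1 / real (Suc k))) ^ 5"
    by (rule Bernoulli_inequality) simp
  moreover have "1 + - (1 / real (Suc k)) = real k / real (k + 1)"
    by (simp add: field_simps)
  ultimately show ?thesis unfolding gamma_pow_def by simp
qed

lemma gamma_pow_bounds: "0 < gamma_pow k" "gamma_pow k \<le> 1"
proof -
  have "(real k / real (k + 1)) ^ 5 < 1 ^ 5"
    by (rule power_strict_mono) auto
  then show "0 < gamma_pow k" by (simp add: gamma_pow_def)
  show "gamma_pow k \<le> 1" by (simp add: gamma_pow_def)
qed

lemma gamma_pow_bigo: "gamma_pow \<in> O(\<lambda>k. 1 / real k)"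
proof (rule bigoI[where c = 5])
  show "\<forall>\<^sub>F k in sequentially. norm (gamma_pow k) \<le> 5 * norm (1 / real k)"
    using eventually_ge_at_top[of 1]
  proof eventually_elim
    case (elim k)
    have "gamma_pow k \<le> 5 / real (Suc k)" by (rule gamma_pow_le)
    also have "\<dots> \<le> 5 / real k" using elim by (intro divide_left_mono) auto
    finally show ?case using gamma_pow_bounds[of k] by simp
  qed
qed

lemma A_pow_increment: "A_pow (Suc k) - A_pow k \<le> 5 * real (Suc k) ^ 4"
proof -
  have "A_pow (Suc k) - A_pow k = gamma_pow k * A_pow (Suc k)"
    unfolding gamma_pow_eq step_coef_def by (simp add: A_pow_def del: of_nat_Suc)
  also have "\<dots> \<le> 5 / real (Suc k) * A_pow (Suc k)"
    by (intro mult_right_mono gamma_pow_le) (simp add: A_pow_def)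
  also have "\<dots> = 5 * real (Suc k) ^ 4"
    by (simp add: A_pow_def power_Suc eval_nat_numeral del: of_nat_Suc)
  finally show ?thesis .
qed

text \<open>
The exponent five makes the summands grow like \<open>i\<close> to the power \<open>2 - 2 \<nu>\<close>, which is monotone for
every \<open>\<nu> \<le> 1\<close>: each summand may be replaced by the last one without losing the order.
\<close>

lemma weighted_power_sum:
  assumes \<nu>: "0 \<le> \<nu>" "\<nu> \<le> 1" and k: "1 \<le> k"
  shows "(\<Sum>i<k. (A_pow (Suc i) - A_pow i) / real (Suc i) powr (2 + 2 * \<nu>)) / A_pow k
     \<le> 5 / real k powr (2 + 2 * \<nu>)"
proof -
  have "(\<Sum>i<k. (A_pow (Suc i) - A_pow i) / real (Suc i) powr (2 + 2 * \<nu>))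
      \<le> (\<Sum>i<k. 5 * real k powr (2 - 2 * \<nu>))"
  proof (rule sum_mono)
    fix i assume i: "i \<in> {..<k}"
    have "(A_pow (Suc i) - A_pow i) / real (Suc i) powr (2 + 2 * \<nu>)
        \<le> 5 * real (Suc i) ^ 4 / real (Suc i) powr (2 + 2 * \<nu>)"
      by (intro divide_right_mono A_pow_increment) simp
    also have "\<dots> = 5 * real (Suc i) powr (4 - (2 + 2 * \<nu>))"
      unfolding powr_diff using powr_realpow[of "real (Suc i)" 4] by simp
    also have "\<dots> \<le> 5 * real k powr (2 - 2 * \<nu>)"
      using i \<nu> by (auto intro!: powr_mono2)
    finally show "(A_pow (Suc i) - A_pow i) / real (Suc i) powr (2 + 2 * \<nu>) \<le> 5 * real k powr (2 - 2 * \<nu>)" .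
  qed
  also have "\<dots> = 5 * real k powr (3 - 2 * \<nu>)"
    using k powr_add[of "real k" 1 "2 - 2 * \<nu>"] by simp
  finally have "(\<Sum>i<k. (A_pow (Suc i) - A_pow i) / real (Suc i) powr (2 + 2 * \<nu>)) / A_pow k
      \<le> 5 * real k powr (3 - 2 * \<nu>) / A_pow k"
    by (intro divide_right_mono) (auto simp: A_pow_def)
  also have "\<dots> = 5 * real k powr (3 - 2 * \<nu> - 5)"
    unfolding powr_diff[of "real k" _ 5] using k powr_realpow[of "real k" 5] by (simp add: A_pow_def)
  also have "\<dots> = 5 / real k powr (2 + 2 * \<nu>)"
    using powr_minus_divide[of "real k" "2 + 2 * \<nu>"] by simp
  finally show ?thesis .
qed

lemma gamma_geo_eq:
  assumes "0 < w"
  shows "gamma_geo w k = step_coef (A_geo w) k"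
proof -
  define b where "b = 1 + 1 / w"
  have b: "0 < b" "(b - 1) / b = 1 / (1 + w)"
    using assms by (auto simp: b_def field_simps add_pos_pos)
  have "step_coef (A_geo w) (Suc j) = (b - 1) / b" for j
  proof -
    have "b ^ Suc (Suc j) - b ^ Suc j = b ^ Suc j * (b - 1)" "b ^ Suc (Suc j) = b ^ Suc j * b"
      by (simp_all add: algebra_simps)
    then show ?thesis
      using b(1) by (simp add: step_coef_def A_geo_def flip: b_def)
  qed
  then show ?thesis
    using b by (cases k) (simp_all add: gamma_geo_def step_coef_def A_geo_def flip: b_def)
qed

lemma A_geo_mono:
  assumes "0 < w"
  shows "A_geo w k < A_geo w (Suc k)"
proof -
  have "1 < 1 + 1 / w" using assms by simp
  from power_strict_increasing[OF _ this, of k "Suc k"] show ?thesis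
    using less_trans[OF zero_less_one \<open>1 < 1 + 1 / w\<close>] by (simp add: A_geo_def del: power_Suc)
qed

text \<open>
The weights grow by the factor \<open>1 + 1/\<omega>\<close>, the inverse of \<open>1 - 1/(1 + \<omega>)\<close>, from the first
step on; hence the exponent \<open>k - 1\<close>.
\<close>

lemma A_geo_ratio:
  assumes "0 < w" "1 \<le> k"
  shows "A_geo w 1 / A_geo w k \<le> exp (- ((real k - 1) / (1 + w)))"
proof -
  obtain j where k: "k = Suc j" using assms(2) by (cases k) auto
  have "1 + 1 / w \<noteq> 0" using assms(1) by (simp add: add_pos_pos less_imp_neq[symmetric])
  then have "A_geo w 1 / A_geo w k = (1 / (1 + 1 / w)) ^ j"
    by (simp add: k A_geo_def power_divide)
  also have "1 / (1 + 1 / w) = 1 + - (1 / (1 + w))"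
    using assms(1) by (simp add: field_simps)
  also have "(1 + - (1 / (1 + w))) ^ j \<le> exp (- (1 / (1 + w))) ^ j"
    using assms(1) by (intro power_mono exp_ge_add_one_self) (simp add: field_simps)
  also have "\<dots> = exp (- ((real k - 1) / (1 + w)))"
    by (simp add: k flip: exp_of_nat_mult)
  finally show ?thesis .
qed

section \<open>Convergence rates\<close>

context strongly_convex_composite
begin

text \<open>
The constant is \<open>5\<^sup>4 \<cdot> 5 / 2\<close>: a factor of at most \<open>5\<^sup>4\<close> from \<open>\<gamma>\<^sub>k \<le> 5 / (k + 1)\<close> raised to the
power \<open>2 + 2 \<nu> \<le> 4\<close>, a factor 5 from the weights, and \<open>1/2\<close> from completing the square.
\<close>

lemma polynomial_rate:
  assumes run: "CDN_run n g Hs \<psi> gamma_pow x" and k: "k \<ge> 1"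
  shows "objective f \<psi> (x k) - opt_value n f \<psi> \<le> gap n f g \<psi> A_pow x k"
    and "gap n f g \<psi> A_pow x k \<le> ereal (3125 / 2 * (H * hpow D \<nu> / \<mu>)
                         * (H * D powr (2 + \<nu>) / real k powr (2 + 2 * \<nu>)))"
proof -
  define M where "M = 625 * ((H * hpow D \<nu> * D)\<^sup>2 / (2 * \<mu>))"
  have M: "0 \<le> M" using mu by (simp add: M_def)
  define \<epsilon> where "\<epsilon> i = M / real (Suc i) powr (2 + 2 * \<nu>)" for i
  have A_mono: "A_pow i < A_pow (Suc i)" for i
    unfolding A_pow_def by (intro power_strict_mono) auto
  have loss: "- \<epsilon> i \<le> gain (gamma_pow i) d e"
    if "0 \<le> d" "d \<le> D" "0 \<le> e" "e \<le> D" for i d e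
  proof -
    have "gamma_pow i powr (2 + 2 * \<nu>) \<le> (5 / real (Suc i)) powr (2 + 2 * \<nu>)"
      using nu gamma_pow_bounds[of i] gamma_pow_le[of i] by (intro powr_mono2) auto
    also have "\<dots> = 5 powr (2 + 2 * \<nu>) / real (Suc i) powr (2 + 2 * \<nu>)"
      by (rule powr_divide)
    also have "\<dots> \<le> 625 / real (Suc i) powr (2 + 2 * \<nu>)"
    proof (rule divide_right_mono)
      have "(5::real) powr (2 + 2 * \<nu>) \<le> 5 powr 4" using nu by (intro powr_mono) auto
      then show "(5::real) powr (2 + 2 * \<nu>) \<le> 625" by (simp add: powr_numeral)
    qed simp
    finally have "gamma_pow i powr (2 + 2 * \<nu>) * ((H * hpow D \<nu> * D)\<^sup>2 / (2 * \<mu>))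
        \<le> 625 / real (Suc i) powr (2 + 2 * \<nu>) * ((H * hpow D \<nu> * D)\<^sup>2 / (2 * \<mu>))"
      using mu by (intro mult_right_mono) auto
    also have "\<dots> = \<epsilon> i" by (simp add: \<epsilon>_def M_def)
    finally have "gamma_pow i powr (2 + 2 * \<nu>) * ((H * hpow D \<nu> * D)\<^sup>2 / (2 * \<mu>)) \<le> \<epsilon> i" .
    with gain_lower_quadratic[OF gamma_pow_bounds that(1-3), of i]
    show ?thesis by linarith
  qed
  note bound = gap_bound[OF run gamma_pow_eq _ A_mono loss k]
  show "objective f \<psi> (x k) - opt_value n f \<psi> \<le> gap n f g \<psi> A_pow x k"
    by (rule bound(1)) (simp add: A_pow_def)
  have "(\<Sum>i<k. (A_pow (Suc i) - A_pow i) * \<epsilon> i) / A_pow k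
      = M * ((\<Sum>i<k. (A_pow (Suc i) - A_pow i) / real (Suc i) powr (2 + 2 * \<nu>)) / A_pow k)"
    by (simp add: \<epsilon>_def sum_distrib_left mult.commute)
  also have "\<dots> \<le> M * (5 / real k powr (2 + 2 * \<nu>))"
    using weighted_power_sum[OF nu k] M by (rule mult_left_mono)
  also have "\<dots> = 3125 / 2 * (H * hpow D \<nu> / \<mu>) * (H * D powr (2 + \<nu>) / real k powr (2 + 2 * \<nu>))"
    unfolding diam_powr M_def by (simp add: power2_eq_square)
  finally show "gap n f g \<psi> A_pow x k \<le> ereal (3125 / 2 * (H * hpow D \<nu> / \<mu>)
                         * (H * D powr (2 + \<nu>) / real k powr (2 + 2 * \<nu>)))"
    by (intro order_trans[OF bound(2)]) (simp_all add: A_pow_def)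
qed

text \<open>
Only the first step loses anything: its coefficient is 1, so the term in \<open>d\<^sup>2\<close> that absorbs
the error in later steps vanishes. That loss is at most \<open>H D\<^sup>2\<^sup>+\<^sup>\<nu> / (1 + \<nu>)\<close> and is damped by the growth of the weights.
\<close>

lemma linear_rate:
  assumes w: "w = omega \<nu> H D \<mu>" "0 < w"
    and run: "CDN_run n g Hs \<psi> (gamma_geo w) x" and k: "k \<ge> 1"
  shows "objective f \<psi> (x k) - opt_value n f \<psi> \<le> gap n f g \<psi> (A_geo w) x k"
    and "gap n f g \<psi> (A_geo w) x k
              \<le> ereal (exp (- ((real k - 1) / (1 + w))) * (H * D powr (2 + \<nu>) / (1 + \<nu>)))"
proof -
  define E where "E = H * D powr (2 + \<nu>) / (1 + \<nu>)"
  have E: "0 \<le> E" using H nu by (simp add: E_def)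
  define \<epsilon> where "\<epsilon> i = (if i = 0 then E else 0)" for i :: nat
  have loss: "- \<epsilon> i \<le> gain (gamma_geo w i) d e"
    if d: "0 \<le> d" "d \<le> D" and e: "0 \<le> e" "e \<le> D" for i d e
  proof (cases "i = 0")
    case True
    have "taylor_error d \<le> H / (1 + \<nu>) * hpow D \<nu> * d"
      using taylor_error_le[of 1 d] d by simp
    also have "\<dots> \<le> H / (1 + \<nu>) * hpow D \<nu> * D"
      using d H nu by (intro mult_left_mono) (auto simp: hpow_nonneg)
    finally have "taylor_error d * e \<le> H / (1 + \<nu>) * hpow D \<nu> * D * D"
      using e d H nu by (intro mult_mono) (auto simp: hpow_nonneg)
    also have "\<dots> = E" by (simp add: E_def diam_powr power2_eq_square)
    moreover have "0 \<le> \<mu> / 2 * e\<^sup>2" using mu by simp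
    ultimately have "- E \<le> \<mu> / 2 * e\<^sup>2 - taylor_error d * e" by linarith
    then show ?thesis
      using True by (simp add: \<epsilon>_def gain_def gamma_geo_def)
  next
    case False
    then show ?thesis
      using gain_nonneg_omega[OF w d e(1)] by (simp add: \<epsilon>_def gamma_geo_def)
  qed
  note bound = gap_bound[OF run gamma_geo_eq[OF w(2)] _ A_geo_mono[OF w(2)] loss k]
  show "objective f \<psi> (x k) - opt_value n f \<psi> \<le> gap n f g \<psi> (A_geo w) x k"
    by (rule bound(1)) (simp add: A_geo_def)
  have "(\<Sum>i<k. (A_geo w (Suc i) - A_geo w i) * \<epsilon> i) = (\<Sum>i<k. if i = 0 then A_geo w 1 * E else 0)"
    by (intro sum.cong) (auto simp: \<epsilon>_def A_geo_def)
  also have "\<dots> = A_geo w 1 * E"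
    using k by simp
  finally have "(\<Sum>i<k. (A_geo w (Suc i) - A_geo w i) * \<epsilon> i) / A_geo w k = A_geo w 1 / A_geo w k * E"
    by simp
  also have "\<dots> \<le> exp (- ((real k - 1) / (1 + w))) * E"
    by (intro mult_right_mono A_geo_ratio w k E)
  finally show "gap n f g \<psi> (A_geo w) x k
              \<le> ereal (exp (- ((real k - 1) / (1 + w))) * (H * D powr (2 + \<nu>) / (1 + \<nu>)))"
    unfolding E_def by (intro order_trans[OF bound(2)]) (simp_all add: A_geo_def)
qed

end

theorem theorem2:
  shows
    "((\<forall>k. gamma_pow k = step_coef A_pow k) \<and> gamma_pow \<in> O(\<lambda>k. 1 / real k) \<and>
      (\<exists>C>0. \<forall>n N f g Hs \<psi> \<nu> H \<mu> x.
         problem n N f g Hs \<psi> \<nu> H \<and> strongly_convex n N \<psi> \<mu> \<and>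
         CDN_run n g Hs \<psi> gamma_pow x \<longrightarrow>
         (\<forall>k\<ge>1.
            objective f \<psi> (x k) - opt_value n f \<psi> \<le> gap n f g \<psi> A_pow x k \<and>
            gap n f g \<psi> A_pow x k
              \<le> ereal (C * (H * hpow (diam n N \<psi>) \<nu> / \<mu>)
                         * (H * diam n N \<psi> powr (2 + \<nu>) / real k powr (2 + 2 * \<nu>)))))) \<and>
     (\<forall>n N f g Hs \<psi> \<nu> H \<mu> x w.
         problem n N f g Hs \<psi> \<nu> H \<and> strongly_convex n N \<psi> \<mu> \<and>
         w = omega \<nu> H (diam n N \<psi>) \<mu> \<and> w > 0 \<and>
         CDN_run n g Hs \<psi> (gamma_geo w) x \<longrightarrow>
         (\<forall>k. gamma_geo w k = step_coef (A_geo w) k) \<and>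
         (\<forall>k\<ge>1.
            objective f \<psi> (x k) - opt_value n f \<psi> \<le> gap n f g \<psi> (A_geo w) x k \<and>
            gap n f g \<psi> (A_geo w) x k
              \<le> ereal (exp (- ((real k - 1) / (1 + w)))
                         * (H * diam n N \<psi> powr (2 + \<nu>) / (1 + \<nu>)))))"
proof (intro conjI)
  show "\<forall>k. gamma_pow k = step_coef A_pow k"
    by (simp add: gamma_pow_eq)
  show "gamma_pow \<in> O(\<lambda>k. 1 / real k)"
    by (rule gamma_pow_bigo)
  show "\<exists>C>0. \<forall>n N f g Hs \<psi> \<nu> H \<mu> x.
         problem n N f g Hs \<psi> \<nu> H \<and> strongly_convex n N \<psi> \<mu> \<and>
         CDN_run n g Hs \<psi> gamma_pow x \<longrightarrow>
         (\<forall>k\<ge>1.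
            objective f \<psi> (x k) - opt_value n f \<psi> \<le> gap n f g \<psi> A_pow x k \<and>
            gap n f g \<psi> A_pow x k
              \<le> ereal (C * (H * hpow (diam n N \<psi>) \<nu> / \<mu>)
                         * (H * diam n N \<psi> powr (2 + \<nu>) / real k powr (2 + 2 * \<nu>))))"
  proof (intro exI[of _ "3125 / 2"] conjI allI impI; (elim conjE)?)
    fix n N f g Hs \<psi> \<nu> H \<mu> x and k :: nat
    assume asm: "problem n N f g Hs \<psi> \<nu> H" "strongly_convex n N \<psi> \<mu>"
      "CDN_run n g Hs \<psi> gamma_pow x" and k: "1 \<le> k"
    interpret strongly_convex_composite n N f g Hs \<psi> \<nu> H \<mu>
      by standard (rule asm)+
    show "objective f \<psi> (x k) - opt_value n f \<psi> \<le> gap n f g \<psi> A_pow x k"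
      "gap n f g \<psi> A_pow x k
              \<le> ereal (3125 / 2 * (H * hpow (diam n N \<psi>) \<nu> / \<mu>)
                         * (H * diam n N \<psi> powr (2 + \<nu>) / real k powr (2 + 2 * \<nu>)))"
      by (rule polynomial_rate[OF asm(3) k])+
  qed simp
next
  show "\<forall>n N f g Hs \<psi> \<nu> H \<mu> x w.
         problem n N f g Hs \<psi> \<nu> H \<and> strongly_convex n N \<psi> \<mu> \<and>
         w = omega \<nu> H (diam n N \<psi>) \<mu> \<and> w > 0 \<and>
         CDN_run n g Hs \<psi> (gamma_geo w) x \<longrightarrow>
         (\<forall>k. gamma_geo w k = step_coef (A_geo w) k) \<and>
         (\<forall>k\<ge>1.
            objective f \<psi> (x k) - opt_value n f \<psi> \<le> gap n f g \<psi> (A_geo w) x k \<and>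
            gap n f g \<psi> (A_geo w) x k
              \<le> ereal (exp (- ((real k - 1) / (1 + w)))
                         * (H * diam n N \<psi> powr (2 + \<nu>) / (1 + \<nu>))))"
  proof (intro allI impI conjI; elim conjE)
    fix n N f g Hs \<psi> \<nu> H \<mu> x w and k :: nat
    assume asm: "problem n N f g Hs \<psi> \<nu> H" "strongly_convex n N \<psi> \<mu>"
      "w = omega \<nu> H (diam n N \<psi>) \<mu>" "w > 0" "CDN_run n g Hs \<psi> (gamma_geo w) x"
    interpret strongly_convex_composite n N f g Hs \<psi> \<nu> H \<mu>
      by standard (rule asm)+
    show "gamma_geo w k = step_coef (A_geo w) k" by (rule gamma_geo_eq[OF asm(4)])
    assume k: "1 \<le> k"
    show "objective f \<psi> (x k) - opt_value n f \<psi> \<le> gap n f g \<psi> (A_geo w) x k"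
      "gap n f g \<psi> (A_geo w) x k
              \<le> ereal (exp (- ((real k - 1) / (1 + w)))
                         * (H * diam n N \<psi> powr (2 + \<nu>) / (1 + \<nu>)))"
      by (rule linear_rate[OF asm(3-5) k])+
  qed
qed

end
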